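(* Let $N\ge 3$ and $N=rq$ with positive integers $r,q$, and let $R$ be a set of $r$ rim vertices of the wheel graph $W_{N+1}$ chosen at equal intervals, i.e. all of whose cyclic intervals satisfy $d_1=d_2=\cdots=d_r=q$. Then $$\mathcal F_{W_{N+1}}(R)=\tau(W_{N+1}/R)=r\left(L_{2q}-2\right)F_{2q}^{\,r-1}.$$
   Context: The wheel graph $W_{N+1}$ ($N\ge3$) has vertex set $\{c,v_1,\ldots,v_N\}$ and edges $\{v_i,v_{i+1}\}$ (indices modulo $N$) and $\{c,v_i\}$ for $1\le i\le N$; $c$ is the central vertex and the $v_i$ are the rim vertices. For a set $R=\{v_{a_1},\ldots,v_{a_r}\}$ of rim vertices with $1\le a_1<\cdots<a_r\le N$, the cyclic intervals are $d_i=a_{i+1}-a_i$ for $1\le i\le r-1$ and $d_r=a_1+N-a_r$. For a finite connected graph $G$ and $\varnothing\ne R\subseteq V(G)$, a rooted spanning forest of $G$ with root set $R$ is a spanning forest (an acyclic subgraph containing all vertices of $G$) in which each connected component contains exactly one vertex of $R$; $\mathcal F_G(R)$ denotes the number of such forests. $G/R$ is the multigraph obtained from $G$ by identifying all vertices of $R$ into a single vertex, keeping multiple edges with their multiplicities and deleting loops. $\tau(H)$ is the number of spanning trees of $H$, where parallel edges are regarded as distinct. Fibonacci numbers: $F_0=0$, $F_1=1$, $F_{n+2}=F_{n+1}+F_n$. Lucas numbers: $L_0=2$, $L_1=1$, $L_{n+2}=L_{n+1}+L_n$. *)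

theory Defs
  imports "HOL-Library.Uprod" "HOL-Number_Theory.Fib"
begin

text \<open>Undirected multigraphs. Edges are labels of their own, so parallel edges stay distinct;
  \<open>ends\<close> assigns to each edge the unordered pair of its end vertices (a loop at \<open>v\<close> has
  \<open>Upair v v\<close>).  The notions \<open>spanning_tree\<close>, \<open>forest\<close> etc. of the AFP entry Graph Theory are not
  used here because their acyclicity refers to directed cycles.\<close>

record ('v, 'e) mgraph =
  verts :: "'v set"
  edges :: "'e set"
  ends :: "'e \<Rightarrow> 'v uprod"

text \<open>Spanning subgraphs correspond to subsets of the edge set.\<close>

definition spanning_subgraph :: "('v, 'e) mgraph \<Rightarrow> 'e set \<Rightarrow> ('v, 'e) mgraph" where
  "spanning_subgraph G F = G\<lparr>edges := F\<rparr>"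

definition adj :: "('v, 'e) mgraph \<Rightarrow> ('v \<times> 'v) set" where
  "adj G = {(u, v). u \<in> verts G \<and> v \<in> verts G \<and> (\<exists>e\<in>edges G. ends G e = Upair u v)}"

definition components :: "('v, 'e) mgraph \<Rightarrow> 'v set set" where
  "components G = verts G // (adj G)\<^sup>*"

definition connected_graph :: "('v, 'e) mgraph \<Rightarrow> bool" where
  "connected_graph G \<longleftrightarrow> verts G \<noteq> {} \<and> (\<forall>u\<in>verts G. \<forall>v\<in>verts G. (u, v) \<in> (adj G)\<^sup>*)"

text \<open>A cycle is given by distinct vertices \<open>v\<^sub>0, \<dots>, v\<^sub>k\<^sub>-\<^sub>1\<close> and distinct edges
  \<open>e\<^sub>0, \<dots>, e\<^sub>k\<^sub>-\<^sub>1\<close> with \<open>e\<^sub>i\<close> joining \<open>v\<^sub>i\<close> to \<open>v\<^sub>i\<^sub>+\<^sub>1\<close> (indices mod \<open>k\<close>), where \<open>k \<ge> 1\<close>; a loop is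
  a cycle with \<open>k = 1\<close>, two parallel edges form one with \<open>k = 2\<close>.\<close>

definition is_cycle :: "('v, 'e) mgraph \<Rightarrow> 'v list \<Rightarrow> 'e list \<Rightarrow> bool" where
  "is_cycle G vs es \<longleftrightarrow>
     es \<noteq> [] \<and> length vs = length es \<and> distinct vs \<and> distinct es \<and>
     set vs \<subseteq> verts G \<and> set es \<subseteq> edges G \<and>
     (\<forall>i<length es. ends G (es ! i) = Upair (vs ! i) (vs ! (Suc i mod length vs)))"

definition acyclic_graph :: "('v, 'e) mgraph \<Rightarrow> bool" where
  "acyclic_graph G \<longleftrightarrow> (\<nexists>vs es. is_cycle G vs es)"

definition spanning_trees :: "('v, 'e) mgraph \<Rightarrow> 'e set set" where
  "spanning_trees G =
     {T. T \<subseteq> edges G \<and> connected_graph (spanning_subgraph G T) \<and>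
         acyclic_graph (spanning_subgraph G T)}"

definition tau :: "('v, 'e) mgraph \<Rightarrow> nat" where
  "tau G = card (spanning_trees G)"

definition rooted_spanning_forests :: "('v, 'e) mgraph \<Rightarrow> 'v set \<Rightarrow> 'e set set" where
  "rooted_spanning_forests G R =
     {F. F \<subseteq> edges G \<and> acyclic_graph (spanning_subgraph G F) \<and>
         (\<forall>C\<in>components (spanning_subgraph G F). \<exists>!v. v \<in> C \<and> v \<in> R)}"

definition num_rooted_forests :: "('v, 'e) mgraph \<Rightarrow> 'v set \<Rightarrow> nat" where
  "num_rooted_forests G R = card (rooted_spanning_forests G R)"

text \<open>\<open>identify G R\<close> is \<open>G/R\<close>: all vertices in \<open>R\<close> become the single vertex \<open>None\<close>, any other vertex
  \<open>v\<close> becomes \<open>Some v\<close>. Edges keep their labels, hence multiplicities; those whose image is a loop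
  are deleted (\<open>proper_uprod\<close> says that the two ends differ).\<close>

definition merge :: "'v set \<Rightarrow> 'v \<Rightarrow> 'v option" where
  "merge R v = (if v \<in> R then None else Some v)"

definition identify :: "('v, 'e) mgraph \<Rightarrow> 'v set \<Rightarrow> ('v option, 'e) mgraph" where
  "identify G R =
     \<lparr>verts = merge R ` verts G,
      edges = {e \<in> edges G. proper_uprod (map_uprod (merge R) (ends G e))},
      ends = (\<lambda>e. map_uprod (merge R) (ends G e))\<rparr>"

text \<open>\<open>wheel N\<close> is the wheel \<open>W\<^sub>N\<^sub>+\<^sub>1\<close>, for \<open>N \<ge> 3\<close>. Being a simple graph, its edges are
  the unordered pairs themselves. The successor of \<open>i\<close> in the cyclic order on \<open>{1..N}\<close> is \<open>i mod N + 1\<close>.\<close>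

datatype wheel_vertex = Center | Rim nat

definition wheel :: "nat \<Rightarrow> (wheel_vertex, wheel_vertex uprod) mgraph" where
  "wheel N =
     \<lparr>verts = insert Center (Rim ` {1..N}),
      edges = {Upair (Rim i) (Rim (i mod N + 1)) | i. i \<in> {1..N}} \<union>
              {Upair Center (Rim i) | i. i \<in> {1..N}},
      ends = (\<lambda>e. e)\<rparr>"

text \<open>The \<open>i\<close>-th cyclic interval (\<open>1 \<le> i \<le> r\<close>) of indices \<open>1 \<le> a 1 < \<dots> < a r \<le> N\<close>; under these
  conditions the truncated subtractions are exact.\<close>

definition cyclic_interval :: "nat \<Rightarrow> nat \<Rightarrow> (nat \<Rightarrow> nat) \<Rightarrow> nat \<Rightarrow> nat" where
  "cyclic_interval N r a i = (if i < r then a (i + 1) - a i else a 1 + N - a r)"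

fun lucas :: "nat \<Rightarrow> nat" where
  "lucas 0 = 2"
| "lucas (Suc 0) = 1"
| "lucas (Suc (Suc n)) = lucas (Suc n) + lucas n"

end

(* A forest rooted at R amounts to an edge set F of size |V - R| that joins every vertex to R; this
   description is insensitive to identifying R, so spanning trees of G/R are the same edge sets.
   For an edge joining a root to a non-root v, deleting it from the forests that contain it makes v
   a root, so n(E + e, U) = n(E, U) + n(E, U - v), where U is the set of non-roots.

   The roots cut the wheel into r fans sharing the centre c. If a fan has S rooted forests with c
   among the roots and T with c not a root, then the spanning trees count as r T S^(r-1), because
   exactly one fan connects c to the roots. The recursion gives S = F_2q and T = L_2q - 2. *)
theory Submission
  imports Defs "HOL-Number_Theory.Cong"
begin

section \<open>Rooted forests and cuts\<close>

text \<open>No set of fewer than \<open>card U\<close> edges is grounded, so a grounded set of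
  exactly that size is minimal: a redundant edge, or a second root in a component, would contradict
  the bound. Cycles therefore occur only in the translation between grounded sets and the given
  notions of forest and tree, and the count itself works on cuts alone.

  The obstacle is that the fans overlap. Neighbouring fans share a root, so each block takes only
  the spoke at its left root; for \<open>r = 1\<close> both ends of the single fan are even the same
  vertex. Hence the fans are cut out of a walk that may revisit roots but no other vertex, and edges
  are labels given by positions on the walk. Labels turn into edges of the wheel only at the end,
  which requires \<open>N \<ge> 3\<close>.

  The constants, with q = m + 1: a fan with rooted centre has F_(2m+2) forests. With free centre
  there are 2 F_(2m+1) - 2 without the spoke at the left root and F_(2m+2) with it, in total
  F_(2m+1) + F_(2m+3) - 2 = L_2q - 2.\<close>

definition crosses :: "'v uprod \<Rightarrow> 'v set \<Rightarrow> bool" where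
  "crosses p W \<longleftrightarrow> set_uprod p \<inter> W \<noteq> {} \<and> \<not> set_uprod p \<subseteq> W"

text \<open>A cut formulation of: every vertex of \<open>U\<close> is joined by edges of \<open>F\<close> to some vertex outside
  \<open>U\<close>. All vertices outside \<open>U\<close> act as roots, so no vertex set has to be carried along.\<close>

definition grounded :: "('e \<Rightarrow> 'v uprod) \<Rightarrow> 'e set \<Rightarrow> 'v set \<Rightarrow> bool" where
  "grounded t F U \<longleftrightarrow> (\<forall>W\<subseteq>U. W \<noteq> {} \<longrightarrow> (\<exists>e\<in>F. crosses (t e) W))"

definition ground_forests :: "('e \<Rightarrow> 'v uprod) \<Rightarrow> 'e set \<Rightarrow> 'v set \<Rightarrow> 'e set set" where
  "ground_forests t E U = {F. F \<subseteq> E \<and> grounded t F U \<and> card F = card U}"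

definition num_ground_forests :: "('e \<Rightarrow> 'v uprod) \<Rightarrow> 'e set \<Rightarrow> 'v set \<Rightarrow> nat" where
  "num_ground_forests t E U = card (ground_forests t E U)"

lemma crosses_Upair [simp]: "crosses (Upair x y) W \<longleftrightarrow> (x \<in> W) \<noteq> (y \<in> W)"
  by (auto simp: crosses_def)

lemma not_crosses_disjoint: "set_uprod p \<inter> W = {} \<Longrightarrow> \<not> crosses p W"
  by (simp add: crosses_def)

lemma crosses_cong: "set_uprod p \<inter> W = set_uprod p \<inter> W' \<Longrightarrow> crosses p W \<longleftrightarrow> crosses p W'"
  by (auto simp: crosses_def)

lemma crossesE:
  assumes "crosses p W"
  obtains x y where "p = Upair x y" "x \<in> W" "y \<notin> W"
proof (cases p)
  case (Upair x y)
  then show thesis using assms that[of x y] that[of y x] by (auto simp: Upair_inject)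
qed

lemma groundedD: "grounded t F U \<Longrightarrow> W \<subseteq> U \<Longrightarrow> W \<noteq> {} \<Longrightarrow> \<exists>e\<in>F. crosses (t e) W"
  by (simp add: grounded_def)

lemma groundedI:
  "(\<And>W. W \<subseteq> U \<Longrightarrow> W \<noteq> {} \<Longrightarrow> \<exists>e\<in>F. crosses (t e) W) \<Longrightarrow> grounded t F U"
  by (simp add: grounded_def)

lemma grounded_empty [simp]: "grounded t F {}"
  by (simp add: grounded_def)

lemma grounded_mono: "grounded t F U \<Longrightarrow> F \<subseteq> F' \<Longrightarrow> U' \<subseteq> U \<Longrightarrow> grounded t F' U'"
  by (rule groundedI) (meson groundedD order_trans subsetD)

text \<open>As \<open>x\<close> is outside \<open>U\<close>, every cut inside \<open>U\<close> that
  contains \<open>v\<close> is crossed by \<open>e\<close>, and no other one is. So adding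
  \<open>e\<close> amounts to making \<open>v\<close> a root.\<close>

lemma grounded_insert_crossing:
  assumes "t e = Upair x v" "x \<notin> U" "v \<in> U"
  shows "grounded t (insert e F) U \<longleftrightarrow> grounded t F (U - {v})"
proof
  assume g: "grounded t (insert e F) U"
  show "grounded t F (U - {v})"
  proof (rule groundedI)
    fix W assume W: "W \<subseteq> U - {v}" "W \<noteq> {}"
    then have "W \<subseteq> U" by blast
    moreover have "\<not> crosses (t e) W" using assms W by auto
    ultimately show "\<exists>e\<in>F. crosses (t e) W" using groundedD[OF g, of W] W by auto
  qed
next
  assume g: "grounded t F (U - {v})"
  show "grounded t (insert e F) U"
  proof (rule groundedI)
    fix W assume W: "W \<subseteq> U" "W \<noteq> {}"
    show "\<exists>e\<in>insert e F. crosses (t e) W"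
    proof (cases "v \<in> W")
      case True
      then have "crosses (t e) W" using W assms by auto
      then show ?thesis by blast
    next
      case False
      then have "W \<subseteq> U - {v}" using W by blast
      then show ?thesis using groundedD[OF g] W by blast
    qed
  qed
qed

lemma grounded_insert_outside:
  assumes "set_uprod (t e) \<inter> U = {}"
  shows "grounded t (insert e F) U \<longleftrightarrow> grounded t F U"
proof -
  have "\<not> crosses (t e) W" if "W \<subseteq> U" for W
    using assms that by (intro not_crosses_disjoint) blast
  then show ?thesis by (auto simp: grounded_def)
qed

text \<open>\<open>e\<close> is the only edge at \<open>p\<close>, so \<open>p\<close> has no way to
  a root except through \<open>x\<close>, and the edges of \<open>F\<close> do not notice whether
  \<open>p\<close> belongs to a cut.\<close>

lemma grounded_insert_leaf:
  assumes "t e = Upair p x" "x \<noteq> p" "p \<in> U" "\<And>e. e \<in> F \<Longrightarrow> p \<notin> set_uprod (t e)"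
  shows "grounded t (insert e F) U \<longleftrightarrow> grounded t F (U - {p})"
proof
  assume g: "grounded t (insert e F) U"
  show "grounded t F (U - {p})"
  proof (rule groundedI)
    fix W assume W: "W \<subseteq> U - {p}" "W \<noteq> {}"
    \<comment> \<open>Adding \<open>p\<close> whenever \<open>x\<close> is in \<open>W\<close> puts
      both ends of \<open>e\<close> on the same side of the cut.\<close>
    define W' where "W' = (if x \<in> W then insert p W else W)"
    have "W' \<subseteq> U" "W' \<noteq> {}" using W assms(3) by (auto simp: W'_def)
    moreover have "\<not> crosses (t e) W'" using W assms(1) by (auto simp: W'_def)
    ultimately obtain e' where e': "e' \<in> F" "crosses (t e') W'"
      using groundedD[OF g] by blast
    moreover have "crosses (t e') W' \<longleftrightarrow> crosses (t e') W"
      using assms(4)[OF e'(1)] by (intro crosses_cong) (auto simp: W'_def)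
    ultimately show "\<exists>e\<in>F. crosses (t e) W" by blast
  qed
next
  assume g: "grounded t F (U - {p})"
  show "grounded t (insert e F) U"
  proof (rule groundedI)
    fix W assume W: "W \<subseteq> U" "W \<noteq> {}"
    show "\<exists>e\<in>insert e F. crosses (t e) W"
    proof (cases "W = {p}")
      case True
      then show ?thesis using assms(1,2) by auto
    next
      case False
      then have "W - {p} \<subseteq> U - {p}" "W - {p} \<noteq> {}" using W by auto
      then obtain e' where e': "e' \<in> F" "crosses (t e') (W - {p})"
        using groundedD[OF g] by metis
      moreover have "crosses (t e') (W - {p}) \<longleftrightarrow> crosses (t e') W"
        using assms(4)[OF e'(1)] by (intro crosses_cong) auto
      ultimately show ?thesis by blast
    qed
  qed
qed

lemma grounded_crossing_edge:
  assumes "grounded t F U" "U \<noteq> {}"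
  obtains e x v where "e \<in> F" "t e = Upair x v" "x \<notin> U" "v \<in> U"
proof -
  obtain e where e: "e \<in> F" "crosses (t e) U" using groundedD[OF assms(1) order_refl assms(2)] by blast
  obtain v x where "t e = Upair v x" "v \<in> U" "x \<notin> U" using e(2) by (rule crossesE)
  then show thesis using that[of e x v] e(1) by (simp add: Upair_inject)
qed

text \<open>Greedy growth: some edge joins a root to a vertex \<open>v\<close> of \<open>U\<close>;
  keep it, make \<open>v\<close> a root and continue. One edge is spent per vertex of
  \<open>U\<close>.\<close>

lemma grounded_subset_card:
  assumes "finite U" "grounded t F U" "finite F"
  obtains F' where "F' \<subseteq> F" "grounded t F' U" "card F' = card U"
proof -
  have "\<exists>F'\<subseteq>F. grounded t F' U \<and> card F' = card U"
    using assms
  proof (induction "card U" arbitrary: U F)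
    case 0
    then show ?case by (intro exI[of _ "{}"]) auto
  next
    case (Suc n)
    then have "U \<noteq> {}" by auto
    then obtain e x v where e: "e \<in> F" "t e = Upair x v" "x \<notin> U" "v \<in> U"
      using grounded_crossing_edge Suc.prems(2) by metis
    have "insert e (F - {e}) = F" using e by blast
    then have g: "grounded t (F - {e}) (U - {v})"
      using grounded_insert_crossing[of t e x v U, OF e(2-4), of "F - {e}"] Suc.prems(2) by simp
    have "n = card (U - {v})" using Suc.hyps(2) e Suc.prems by simp
    from Suc.hyps(1)[OF this _ g] Suc.prems obtain F' where
      F': "F' \<subseteq> F - {e}" "grounded t F' (U - {v})" "card F' = card (U - {v})" by auto
    have "grounded t (insert e F') U" using grounded_insert_crossing[of t e x v U, OF e(2-4)] F' by simp
    moreover have "e \<notin> F'" "finite F'" using F' Suc.prems(3) finite_subset by auto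
    then have "card (insert e F') = card U" using F' \<open>n = _\<close> Suc.hyps(2) by simp
    ultimately show ?case using F' e by (intro exI[of _ "insert e F'"]) auto
  qed
  then show thesis using that by blast
qed

lemma grounded_card_le:
  assumes "finite U" "finite F" "grounded t F U"
  shows "card U \<le> card F"
proof -
  obtain F' where "F' \<subseteq> F" "card F' = card U"
    by (rule grounded_subset_card[OF assms(1,3,2)])
  then show ?thesis using card_mono[OF assms(2), of F'] by simp
qed

section \<open>Counting by deletion of one edge\<close>

lemma finite_ground_forests [simp]: "finite E \<Longrightarrow> finite (ground_forests t E U)"
  unfolding ground_forests_def by (rule finite_subset[of _ "Pow E"]) auto

lemma num_ground_forests_empty [simp]:
  assumes "finite E"
  shows "num_ground_forests t E {} = 1"
proof -
  have "ground_forests t E {} = {{}}"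
    using assms by (auto simp: ground_forests_def dest: finite_subset)
  then show ?thesis by (simp add: num_ground_forests_def)
qed

lemma num_ground_forests_eq_0:
  assumes "\<And>e. e \<in> E \<Longrightarrow> set_uprod (t e) \<subseteq> U" "U \<noteq> {}"
  shows "num_ground_forests t E U = 0"
proof -
  have "\<not> grounded t F U" if "F \<subseteq> E" for F
  proof
    assume "grounded t F U"
    then obtain e x v where "e \<in> F" "t e = Upair x v" "x \<notin> U"
      using grounded_crossing_edge assms(2) by metis
    then show False using assms(1)[of e] that by auto
  qed
  then have "ground_forests t E U = {}" by (auto simp: ground_forests_def)
  then show ?thesis by (simp add: num_ground_forests_def)
qed

lemma ground_forests_insert:
  assumes "e \<notin> E"
  shows "ground_forests t (insert e E) U =
    ground_forests t E U \<union>
    insert e ` {F. F \<subseteq> E \<and> grounded t (insert e F) U \<and> card (insert e F) = card U}"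
    (is "?L = _ \<union> insert e ` ?R")
proof (intro equalityI subsetI)
  fix F assume F: "F \<in> ?L"
  show "F \<in> ground_forests t E U \<union> insert e ` ?R"
  proof (cases "e \<in> F")
    case True
    then have "insert e (F - {e}) = F" by blast
    then have "F - {e} \<in> ?R" using F by (auto simp: ground_forests_def)
    then have "F \<in> insert e ` ?R"
      using \<open>insert e (F - {e}) = F\<close> by (intro image_eqI[of F _ "F - {e}"]) simp_all
    then show ?thesis by (rule UnI2)
  qed (use F in \<open>auto simp: ground_forests_def\<close>)
qed (auto simp: ground_forests_def)

text \<open>Removing \<open>e\<close> maps the forests that contain it bijectively to those counted
  by the second term. The equivalence for \<open>grounded\<close> is a hypothesis because it arises
  in two ways: \<open>e\<close> joins \<open>v\<close> to a root, or \<open>e\<close> is the only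
  edge at \<open>v\<close>.\<close>

lemma num_ground_forests_insert:
  assumes "e \<notin> E" "finite E"
    and "\<And>F. F \<subseteq> E \<Longrightarrow> grounded t (insert e F) U \<longleftrightarrow> grounded t F (U - {v})"
    and "v \<in> U" "finite U"
  shows "num_ground_forests t (insert e E) U =
    num_ground_forests t E U + num_ground_forests t E (U - {v})"
proof -
  let ?R = "ground_forests t E (U - {v})"
  have "card (insert e F) = card U \<longleftrightarrow> card F = card (U - {v})" if "F \<subseteq> E" for F
  proof -
    have "e \<notin> F" "finite F" using that assms(1,2) finite_subset by auto
    moreover have "card U > 0" using assms(4,5) card_gt_0_iff by blast
    ultimately show ?thesis using assms(4,5) by auto
  qed
  then have eq: "ground_forests t (insert e E) U = ground_forests t E U \<union> insert e ` ?R"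
    unfolding ground_forests_insert[OF assms(1)] using assms(3)
    by (auto simp: ground_forests_def intro!: arg_cong2[where f = "(\<union>)"] image_cong)
  have "inj_on (insert e) ?R"
    using assms(1) by (intro inj_onI) (auto simp: ground_forests_def)
  moreover have "ground_forests t E U \<inter> insert e ` ?R = {}"
    using assms(1) by (auto simp: ground_forests_def)
  ultimately show ?thesis
    using assms(2) unfolding num_ground_forests_def eq
    by (simp add: card_Un_disjoint card_image)
qed

lemma num_ground_forests_crossing:
  assumes "e \<notin> E" "finite E" "t e = Upair x v" "x \<notin> U" "v \<in> U" "finite U"
  shows "num_ground_forests t (insert e E) U =
    num_ground_forests t E U + num_ground_forests t E (U - {v})"
  by (rule num_ground_forests_insert[OF assms(1,2) grounded_insert_crossing[of t e x v U, OF assms(3-5)] assms(5,6)])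

text \<open>An edge between two roots crosses no cut inside \<open>U\<close>; a forest containing it
  would stay grounded without it and have too few edges.\<close>

lemma num_ground_forests_outside:
  assumes "finite E" "set_uprod (t e) \<inter> U = {}" "finite U"
  shows "num_ground_forests t (insert e E) U = num_ground_forests t E U"
proof (cases "e \<in> E")
  case False
  have "\<not> (grounded t (insert e F) U \<and> card (insert e F) = card U)" if "F \<subseteq> E" for F
  proof -
    have "e \<notin> F" "finite F" using that False assms finite_subset by auto
    then show ?thesis
      using grounded_card_le[of U F t] assms grounded_insert_outside[of t e U F] by auto
  qed
  then have "ground_forests t (insert e E) U = ground_forests t E U"
    unfolding ground_forests_insert[OF False] by auto
  then show ?thesis by (simp add: num_ground_forests_def)
qed (simp add: insert_absorb)

text \<open>Without \<open>e\<close> the cut \<open>{p}\<close> is uncrossed, so \<open>e\<close> is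
  forced and only one term of the recursion survives.\<close>

lemma num_ground_forests_leaf:
  assumes "e \<notin> E" "finite E" "t e = Upair p x" "x \<noteq> p" "p \<in> U" "finite U"
    and "\<And>e. e \<in> E \<Longrightarrow> p \<notin> set_uprod (t e)"
  shows "num_ground_forests t (insert e E) U = num_ground_forests t E (U - {p})"
proof -
  have "\<not> grounded t F U" if "F \<subseteq> E" for F
  proof
    assume "grounded t F U"
    then obtain e' where "e' \<in> F" "crosses (t e') {p}"
      using groundedD[of t F U "{p}"] assms(5) by auto
    then show False using assms(7)[of e'] that not_crosses_disjoint[of "t e'" "{p}"] by auto
  qed
  then have "ground_forests t E U = {}" by (auto simp: ground_forests_def)
  then have "num_ground_forests t E U = 0" by (simp add: num_ground_forests_def)
  moreover have "num_ground_forests t (insert e E) U =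
      num_ground_forests t E U + num_ground_forests t E (U - {p})"
  proof (rule num_ground_forests_insert[OF assms(1,2) _ assms(5,6)])
    fix F assume "F \<subseteq> E"
    then show "grounded t (insert e F) U \<longleftrightarrow> grounded t F (U - {p})"
      using grounded_insert_leaf[of t e p x U F, OF assms(3-5)] assms(7) by blast
  qed
  ultimately show ?thesis by simp
qed

text \<open>This carries counts over walk labels to the wheel, whose edges are the unordered pairs
  themselves.\<close>

lemma num_ground_forests_image:
  assumes "inj_on f L"
  shows "num_ground_forests (\<lambda>e. e) (f ` L) U = num_ground_forests f L U"
proof -
  have g: "grounded (\<lambda>e. e) (f ` F) U \<longleftrightarrow> grounded f F U" for F
    by (simp add: grounded_def)
  have c: "card (f ` F) = card F" if "F \<subseteq> L" for F
    using assms that card_image inj_on_subset by blast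
  have "ground_forests (\<lambda>e. e) (f ` L) U = (`) f ` ground_forests f L U"
    by (auto simp: ground_forests_def g c subset_image_iff)
  moreover have "inj_on ((`) f) (ground_forests f L U)"
    using assms by (intro inj_onI) (auto simp: ground_forests_def inj_on_image_eq_iff)
  ultimately show ?thesis by (simp add: num_ground_forests_def card_image)
qed

section \<open>Gluing two edge sets along roots and at most one further vertex\<close>

lemma grounded_Un:
  assumes "grounded t F1 U1" "grounded t F2 U2"
    and "\<And>e. e \<in> F1 \<Longrightarrow> set_uprod (t e) \<inter> U2 = {}"
  shows "grounded t (F1 \<union> F2) (U1 \<union> U2)"
proof (rule groundedI)
  fix W assume W: "W \<subseteq> U1 \<union> U2" "W \<noteq> {}"
  show "\<exists>e\<in>F1 \<union> F2. crosses (t e) W"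
  proof (cases "W \<inter> U1 = {}")
    case True
    then have "W \<subseteq> U2" using W by blast
    then show ?thesis using groundedD[OF assms(2)] W by blast
  next
    case False
    then obtain e where e: "e \<in> F1" "crosses (t e) (W \<inter> U1)"
      using groundedD[OF assms(1), of "W \<inter> U1"] by blast
    \<comment> \<open>Edges of \<open>F1\<close> do not meet \<open>U2\<close>. Edges of
      \<open>F2\<close> may meet \<open>U1\<close>, which is what later allows \<open>U1\<close> to
      contain the shared vertex.\<close>
    moreover have "crosses (t e) (W \<inter> U1) \<longleftrightarrow> crosses (t e) W"
      using assms(3)[OF e(1)] W(1) by (intro crosses_cong) blast
    ultimately show ?thesis by blast
  qed
qed

lemma grounded_Un_left:
  assumes "grounded t (F1 \<union> F2) U'" "U \<subseteq> U'"
    and "\<And>e. e \<in> F2 \<Longrightarrow> set_uprod (t e) \<inter> U = {}"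
  shows "grounded t F1 U"
proof (rule groundedI)
  fix W assume W: "W \<subseteq> U" "W \<noteq> {}"
  then have "W \<subseteq> U'" using assms(2) by blast
  then obtain e where e: "e \<in> F1 \<union> F2" "crosses (t e) W"
    using groundedD[OF assms(1)] W(2) by blast
  have "e \<notin> F2"
  proof
    assume "e \<in> F2"
    then have "set_uprod (t e) \<inter> W = {}" using assms(3) W(1) by blast
    then show False using e(2) not_crosses_disjoint by blast
  qed
  then show "\<exists>e\<in>F1. crosses (t e) W" using e by blast
qed

context
  fixes t :: "'e \<Rightarrow> 'v uprod" and E1 E2 :: "'e set" and U1 U2 :: "'v set"
  assumes fin: "finite E1" "finite E2" "finite U1" "finite U2"
    and disj: "E1 \<inter> E2 = {}" "U1 \<inter> U2 = {}"
    and avoid1: "\<And>e. e \<in> E1 \<Longrightarrow> set_uprod (t e) \<inter> U2 = {}"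
    and avoid2: "\<And>e. e \<in> E2 \<Longrightarrow> set_uprod (t e) \<inter> U1 = {}"
begin

lemma grounded_Un_parts:
  assumes "F1 \<subseteq> E1" "F2 \<subseteq> E2" "grounded t (F1 \<union> F2) (U1 \<union> U2)"
  shows "grounded t F1 U1" "grounded t F2 U2"
proof -
  show "grounded t F1 U1"
    by (rule grounded_Un_left[OF assms(3)]) (use assms(2) avoid2 in auto)
  have "grounded t (F2 \<union> F1) (U1 \<union> U2)" using assms(3) by (simp add: Un_commute)
  then show "grounded t F2 U2"
    by (rule grounded_Un_left) (use assms(1) avoid1 in auto)
qed

text \<open>\<open>A\<close> and \<open>B\<close> are arbitrary so that either of them may contain
  the shared vertex.\<close>

lemma card_ground_forests_pairs:
  "card {F1 \<union> F2 | F1 F2. F1 \<in> ground_forests t E1 A \<and> F2 \<in> ground_forests t E2 B}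
     = num_ground_forests t E1 A * num_ground_forests t E2 B"
proof -
  let ?X = "ground_forests t E1 A \<times> ground_forests t E2 B"
  have "{F1 \<union> F2 | F1 F2. F1 \<in> ground_forests t E1 A \<and> F2 \<in> ground_forests t E2 B}
      = (\<lambda>(F1, F2). F1 \<union> F2) ` ?X" by auto
  moreover have "inj_on (\<lambda>(F1, F2). F1 \<union> F2) ?X"
    using disj(1) by (intro inj_onI) (auto simp: ground_forests_def; blast)
  ultimately show ?thesis
    by (simp add: card_image card_cartesian_product num_ground_forests_def)
qed

text \<open>Both parts of a forest are grounded and need at least \<open>card U1\<close> and
  \<open>card U2\<close> edges. The total size leaves no slack, so each part has exactly its least
  size.\<close>

lemma num_ground_forests_Un:
  "num_ground_forests t (E1 \<union> E2) (U1 \<union> U2) =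
     num_ground_forests t E1 U1 * num_ground_forests t E2 U2"
proof -
  have "ground_forests t (E1 \<union> E2) (U1 \<union> U2) =
    {F1 \<union> F2 | F1 F2. F1 \<in> ground_forests t E1 U1 \<and> F2 \<in> ground_forests t E2 U2}" (is "?L = ?R")
  proof (intro equalityI subsetI)
    fix F assume F: "F \<in> ?L"
    define F1 F2 where "F1 = F \<inter> E1" and "F2 = F \<inter> E2"
    have FF: "F = F1 \<union> F2" "F1 \<subseteq> E1" "F2 \<subseteq> E2" "F1 \<inter> F2 = {}"
      using F disj by (auto simp: F1_def F2_def ground_forests_def)
    have f: "finite F1" "finite F2" using finite_subset[OF FF(2) fin(1)] finite_subset[OF FF(3) fin(2)] by simp_all
    have g: "grounded t F1 U1" "grounded t F2 U2"
      using grounded_Un_parts[OF FF(2,3)] F FF(1) by (auto simp: ground_forests_def)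
    have "card F1 + card F2 = card U1 + card U2"
      using F f FF fin disj by (simp add: ground_forests_def card_Un_disjoint)
    moreover have "card U1 \<le> card F1" "card U2 \<le> card F2"
      by (rule grounded_card_le[OF fin(3) f(1) g(1)], rule grounded_card_le[OF fin(4) f(2) g(2)])
    ultimately have "F1 \<in> ground_forests t E1 U1" "F2 \<in> ground_forests t E2 U2"
      using g FF by (auto simp: ground_forests_def)
    then show "F \<in> ?R" using FF by blast
  next
    fix F assume "F \<in> ?R"
    then obtain F1 F2 where F: "F = F1 \<union> F2" "F1 \<in> ground_forests t E1 U1"
      "F2 \<in> ground_forests t E2 U2" by blast
    then have s: "F1 \<subseteq> E1" "F2 \<subseteq> E2" and g: "grounded t F1 U1" "grounded t F2 U2"
      and c: "card F1 = card U1" "card F2 = card U2" by (auto simp: ground_forests_def)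
    have f: "finite F1" "finite F2" using finite_subset[OF s(1) fin(1)] finite_subset[OF s(2) fin(2)] by simp_all
    have "grounded t (F1 \<union> F2) (U1 \<union> U2)"
      using g avoid1 s by (intro grounded_Un) auto
    then have "grounded t F (U1 \<union> U2)" using F(1) by simp
    moreover have "card F = card (U1 \<union> U2)"
      using F(1) c s disj f fin by (subst F(1), subst card_Un_disjoint) (auto simp: card_Un_disjoint)
    ultimately show "F \<in> ?L" using F s by (auto simp: ground_forests_def)
  qed
  then show ?thesis by (simp add: num_ground_forests_def card_ground_forests_pairs)
qed

text \<open>If neither part ties \<open>c\<close> to a root, each has an uncrossed cut. Both cuts
  contain \<open>c\<close>, because the parts do ground \<open>U1\<close> and \<open>U2\<close>; so
  the edges of either part see the union of the cuts as their own cut, and the union is uncrossed as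
  well.\<close>

lemma grounded_parallel_aux:
  assumes "F1 \<subseteq> E1" "F2 \<subseteq> E2" "c \<notin> U1" "c \<notin> U2"
    and "grounded t (F1 \<union> F2) (insert c (U1 \<union> U2))"
  shows "grounded t F1 (insert c U1) \<or> grounded t F2 (insert c U2)"
proof (rule ccontr)
  assume neg: "\<not> ?thesis"
  then obtain W1 where
    W1: "W1 \<subseteq> insert c U1" "W1 \<noteq> {}" "\<And>e. e \<in> F1 \<Longrightarrow> \<not> crosses (t e) W1"
    unfolding grounded_def by blast
  from neg obtain W2 where
    W2: "W2 \<subseteq> insert c U2" "W2 \<noteq> {}" "\<And>e. e \<in> F2 \<Longrightarrow> \<not> crosses (t e) W2"
    unfolding grounded_def by blast
  have g: "grounded t F1 U1" "grounded t F2 U2"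
    using grounded_Un_parts[OF assms(1,2)] grounded_mono[OF assms(5)] by blast+
  have "\<not> W1 \<subseteq> U1" using groundedD[OF g(1), of W1] W1(2,3) by blast
  then have c1: "c \<in> W1" using W1 by blast
  have "\<not> W2 \<subseteq> U2" using groundedD[OF g(2), of W2] W2(2,3) by blast
  then have c2: "c \<in> W2" using W2 by blast
  have "W1 \<union> W2 \<subseteq> insert c (U1 \<union> U2)" "W1 \<union> W2 \<noteq> {}" using W1 W2 by auto
  then obtain e where e: "e \<in> F1 \<union> F2" "crosses (t e) (W1 \<union> W2)"
    using groundedD[OF assms(5)] by metis
  show False
  proof (cases "e \<in> F1")
    case True
    then have "crosses (t e) (W1 \<union> W2) \<longleftrightarrow> crosses (t e) W1"
      using avoid1[of e] assms(1) W2(1) c1 by (intro crosses_cong) blast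
    then show False using W1(3)[OF True] e by simp
  next
    case False
    then have e2: "e \<in> F2" using e by blast
    then have "crosses (t e) (W1 \<union> W2) \<longleftrightarrow> crosses (t e) W2"
      using avoid2[of e] assms(2) W1(1) c2 by (intro crosses_cong) blast
    then show False using W2(3)[OF e2] e by simp
  qed
qed

end

text \<open>A forest has \<open>card U1 + card U2 + 1\<close> edges, so exactly one part has an edge
  to spare, and that part is the one that ties \<open>c\<close> to a root. The two products count
  disjoint sets, since the size of the part in \<open>E1\<close> tells them apart.\<close>

lemma num_ground_forests_parallel:
  assumes fin: "finite E1" "finite E2" "finite U1" "finite U2"
    and disj: "E1 \<inter> E2 = {}" "U1 \<inter> U2 = {}" "c \<notin> U1" "c \<notin> U2"
    and avoid1: "\<And>e. e \<in> E1 \<Longrightarrow> set_uprod (t e) \<inter> U2 = {}"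
    and avoid2: "\<And>e. e \<in> E2 \<Longrightarrow> set_uprod (t e) \<inter> U1 = {}"
  shows "num_ground_forests t (E1 \<union> E2) (insert c (U1 \<union> U2)) =
     num_ground_forests t E1 (insert c U1) * num_ground_forests t E2 U2 +
     num_ground_forests t E1 U1 * num_ground_forests t E2 (insert c U2)"
proof -
  let ?A = "{F1 \<union> F2 | F1 F2. F1 \<in> ground_forests t E1 (insert c U1) \<and> F2 \<in> ground_forests t E2 U2}"
  let ?B = "{F1 \<union> F2 | F1 F2. F1 \<in> ground_forests t E1 U1 \<and> F2 \<in> ground_forests t E2 (insert c U2)}"
  let ?L = "ground_forests t (E1 \<union> E2) (insert c (U1 \<union> U2))"
  have "?L = ?A \<union> ?B"
  proof (intro equalityI subsetI)
    fix F assume F: "F \<in> ?L"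
    define F1 F2 where "F1 = F \<inter> E1" and "F2 = F \<inter> E2"
    have FF: "F = F1 \<union> F2" "F1 \<subseteq> E1" "F2 \<subseteq> E2" "F1 \<inter> F2 = {}"
      using F disj by (auto simp: F1_def F2_def ground_forests_def)
    have f: "finite F1" "finite F2" using finite_subset[OF FF(2) fin(1)] finite_subset[OF FF(3) fin(2)] by simp_all
    have gF: "grounded t (F1 \<union> F2) (insert c (U1 \<union> U2))"
      using F FF by (simp add: ground_forests_def)
    have g: "grounded t F1 U1" "grounded t F2 U2"
      by (rule grounded_Un_parts[OF fin disj(1,2) avoid1 avoid2 FF(2,3)];
          use grounded_mono[OF gF] in blast)+
    have sum: "card F1 + card F2 = Suc (card U1 + card U2)"
      using F f FF fin disj by (simp add: ground_forests_def card_Un_disjoint)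
    have le: "card U1 \<le> card F1" "card U2 \<le> card F2"
      by (rule grounded_card_le[OF fin(3) f(1) g(1)], rule grounded_card_le[OF fin(4) f(2) g(2)])
    from grounded_parallel_aux[OF fin disj(1,2) avoid1 avoid2 FF(2,3) disj(3,4) gF]
    consider "grounded t F1 (insert c U1)" | "grounded t F2 (insert c U2)" by blast
    then show "F \<in> ?A \<union> ?B"
    proof cases
      case 1
      then have "card (insert c U1) \<le> card F1"
        by (intro grounded_card_le) (use fin f in auto)
      then have "F1 \<in> ground_forests t E1 (insert c U1)" "F2 \<in> ground_forests t E2 U2"
        using 1 g FF sum le disj fin by (auto simp: ground_forests_def)
      then show ?thesis using FF by blast
    next
      case 2
      then have "card (insert c U2) \<le> card F2"
        by (intro grounded_card_le) (use fin f in auto)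
      then have "F1 \<in> ground_forests t E1 U1" "F2 \<in> ground_forests t E2 (insert c U2)"
        using 2 g FF sum le disj fin by (auto simp: ground_forests_def)
      then show ?thesis using FF by blast
    qed
  next
    have card: "card (F1 \<union> F2) = card F1 + card F2" if "F1 \<subseteq> E1" "F2 \<subseteq> E2" for F1 F2
      using that fin disj finite_subset by (intro card_Un_disjoint) auto
    have cU: "card (insert c (U1 \<union> U2)) = Suc (card U1 + card U2)"
      using fin disj by (simp add: card_Un_disjoint)
    fix F assume "F \<in> ?A \<union> ?B"
    then show "F \<in> ?L"
    proof
      assume "F \<in> ?A"
      then obtain F1 F2 where F: "F = F1 \<union> F2" "F1 \<in> ground_forests t E1 (insert c U1)"
        "F2 \<in> ground_forests t E2 U2" by blast
      then have s: "F1 \<subseteq> E1" "F2 \<subseteq> E2" by (auto simp: ground_forests_def)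
      have "grounded t F (insert c (U1 \<union> U2))"
        unfolding F(1) using F s avoid1 grounded_Un[of t F1 "insert c U1" F2 U2]
        by (auto simp: ground_forests_def)
      moreover have "card F = card (insert c (U1 \<union> U2))"
        using F s card[OF s] cU fin disj by (simp add: ground_forests_def)
      ultimately show ?thesis using F(1) s by (auto simp: ground_forests_def)
    next
      assume "F \<in> ?B"
      then obtain F1 F2 where F: "F = F1 \<union> F2" "F1 \<in> ground_forests t E1 U1"
        "F2 \<in> ground_forests t E2 (insert c U2)" by blast
      then have s: "F1 \<subseteq> E1" "F2 \<subseteq> E2" by (auto simp: ground_forests_def)
      \<comment> \<open>The parts are swapped because edges of \<open>F1\<close> may meet
        \<open>c\<close>, and \<open>grounded_Un\<close> keeps the edges of its first part away from
        the second vertex set.\<close>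
      have "grounded t (F2 \<union> F1) (insert c (U2 \<union> U1))"
        using F s avoid2 grounded_Un[of t F2 "insert c U2" F1 U1]
        by (auto simp: ground_forests_def)
      then have "grounded t F (insert c (U1 \<union> U2))" using F by (simp add: Un_commute)
      moreover have "card F = card (insert c (U1 \<union> U2))"
        using F s card[OF s] cU fin disj by (simp add: ground_forests_def)
      ultimately show ?thesis using F(1) s by (auto simp: ground_forests_def)
    qed
  qed
  moreover have "?A \<inter> ?B = {}"
  proof -
    have False if "F1 \<union> F2 = F1' \<union> F2'" "F1 \<in> ground_forests t E1 (insert c U1)"
      "F1' \<in> ground_forests t E1 U1" "F2 \<in> ground_forests t E2 U2"
      "F2' \<in> ground_forests t E2 (insert c U2)" for F1 F1' F2 F2'
    proof -
      have "F1 \<subseteq> E1" "F1' \<subseteq> E1" "F2 \<subseteq> E2" "F2' \<subseteq> E2"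
        using that by (simp_all add: ground_forests_def)
      then have "F1 = F1'" using that(1) disj(1) by blast
      then show False using that(2,3) disj(3) fin(3) by (simp add: ground_forests_def)
    qed
    then show ?thesis by blast
  qed
  moreover have "finite ?L" using fin by simp
  ultimately have "card ?L = card ?A + card ?B"
    by (metis (no_types, lifting) card_Un_disjoint finite_Un)
  then show ?thesis
    using card_ground_forests_pairs[OF fin disj(1,2) avoid1 avoid2]
    by (simp add: num_ground_forests_def)
qed

section \<open>Spanning trees of the quotient graph\<close>

text \<open>One edge fewer falls below the least size of a grounded set. In this form the size
  condition excludes both cycles and loops.\<close>

lemma ground_forests_minimal:
  assumes "finite E" "finite U" "F \<in> ground_forests t E U" "e \<in> F"
  shows "\<not> grounded t (F - {e}) U"
proof
  assume g: "grounded t (F - {e}) U"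
  have F: "finite F" "card F = card U"
    using assms finite_subset by (auto simp: ground_forests_def)
  have "card U \<le> card (F - {e})"
    by (rule grounded_card_le[OF assms(2) _ g]) (use F in simp)
  moreover have "card (F - {e}) < card F" using F(1) assms(4) by (rule card_Diff1_less)
  ultimately show False using F(2) by simp
qed

section \<open>Paths and reachability\<close>

lemma rtrancl_leaves_set:
  assumes "(a, b) \<in> r\<^sup>*" "a \<in> W" "b \<notin> W"
  obtains x y where "(x, y) \<in> r" "x \<in> W" "y \<notin> W"
proof -
  have "b \<in> W \<or> (\<exists>x y. (x, y) \<in> r \<and> x \<in> W \<and> y \<notin> W)"
    using assms(1) by (induction rule: rtrancl_induct) (use assms(2) in blast)+
  then show thesis using that assms(3) by blast
qed

text \<open>In a shortest path a repeated vertex could be cut out. Simple paths are needed because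
  the vertices of a cycle must be distinct.\<close>

lemma rtrancl_simple_path:
  assumes "(x, y) \<in> r\<^sup>*"
  obtains n f where "f 0 = x" "f n = y" "\<And>i. i < n \<Longrightarrow> (f i, f (Suc i)) \<in> r" "inj_on f {..n}"
proof -
  define n where "n = (LEAST n. (x, y) \<in> r ^^ n)"
  have "\<exists>n. (x, y) \<in> r ^^ n" using assms rtrancl_power by blast
  then have "(x, y) \<in> r ^^ n" unfolding n_def by (rule LeastI_ex)
  then obtain f where f: "f 0 = x" "f n = y" "\<And>i. i < n \<Longrightarrow> (f i, f (Suc i)) \<in> r"
    unfolding relpow_fun_conv by blast
  have sub: "(f i, f j) \<in> r ^^ (j - i)" if "i \<le> j" "j \<le> n" for i j
    unfolding relpow_fun_conv by (rule exI[of _ "\<lambda>k. f (i + k)"]) (use that f(3) in auto)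
  have False if ij: "i < j" "j \<le> n" "f i = f j" for i j
  proof -
    have "(x, f i) \<in> r ^^ i" "(f i, y) \<in> r ^^ (n - j)"
      using sub[of 0 i] sub[of j n] ij f(1,2) by auto
    then have "(x, y) \<in> r ^^ (i + (n - j))" unfolding relpow_add by blast
    then have "n \<le> i + (n - j)" unfolding n_def by (rule Least_le)
    then show False using ij by simp
  qed
  then have "inj_on f {..n}"
    by (intro inj_onI) (metis atMost_iff linorder_neqE_nat)
  then show thesis using that f by blast
qed

lemma verts_spanning_subgraph [simp]: "verts (spanning_subgraph G F) = verts G"
  and edges_spanning_subgraph [simp]: "edges (spanning_subgraph G F) = F"
  and ends_spanning_subgraph [simp]: "ends (spanning_subgraph G F) = ends G"
  by (simp_all add: spanning_subgraph_def)

lemma adj_spanning_subgraph: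
  "(u, v) \<in> adj (spanning_subgraph G F) \<longleftrightarrow>
     u \<in> verts G \<and> v \<in> verts G \<and> (\<exists>e\<in>F. ends G e = Upair u v)"
  by (simp add: adj_def)

lemma sym_adj: "sym (adj G)"
  by (auto simp: sym_def adj_def Upair_inject) (metis Upair_inject)+

lemma adj_rtrancl_sym: "(u, v) \<in> (adj G)\<^sup>* \<Longrightarrow> (v, u) \<in> (adj G)\<^sup>*"
  using sym_rtrancl[OF sym_adj, of G] by (rule symD)

lemma adj_rtrancl_mono:
  "F \<subseteq> F' \<Longrightarrow> (adj (spanning_subgraph G F))\<^sup>* \<subseteq> (adj (spanning_subgraph G F'))\<^sup>*"
  by (rule rtrancl_mono) (auto simp: adj_def)

lemma adj_rtrancl_verts: "(u, v) \<in> (adj G)\<^sup>* \<Longrightarrow> u \<in> verts G \<Longrightarrow> v \<in> verts G"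
  by (induction rule: rtrancl_induct) (auto simp: adj_def)

lemma in_components: "C \<in> components G \<longleftrightarrow> (\<exists>v\<in>verts G. C = (adj G)\<^sup>* `` {v})"
  by (auto simp: components_def quotient_def)

section \<open>Grounded sets as forests and trees of a finite multigraph\<close>

locale finite_mgraph =
  fixes G :: "('v, 'e) mgraph"
  assumes finite_verts: "finite (verts G)"
    and finite_edges: "finite (edges G)"
    and ends_verts: "e \<in> edges G \<Longrightarrow> set_uprod (ends G e) \<subseteq> verts G"
begin

abbreviation reach :: "'e set \<Rightarrow> ('v \<times> 'v) set" where
  "reach F \<equiv> (adj (spanning_subgraph G F))\<^sup>*"

lemma edge_reach:
  assumes "F \<subseteq> edges G" "e \<in> F" "ends G e = Upair x y"
  shows "(x, y) \<in> adj (spanning_subgraph G F)"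
proof -
  have "{x, y} \<subseteq> verts G" using ends_verts[of e] assms by auto
  then show ?thesis using assms by (auto simp: adj_spanning_subgraph)
qed

text \<open>The set of vertices reachable from \<open>v\<close> is an uncrossed cut, so it must
  contain a root; conversely, a path from a cut to a root leaves the cut along a crossing
  edge.\<close>

lemma grounded_iff_reach:
  assumes "F \<subseteq> edges G"
  shows "grounded (ends G) F (verts G - R) \<longleftrightarrow> (\<forall>v\<in>verts G. \<exists>z\<in>R. (v, z) \<in> reach F)"
proof
  assume g: "grounded (ends G) F (verts G - R)"
  show "\<forall>v\<in>verts G. \<exists>z\<in>R. (v, z) \<in> reach F"
  proof (rule ballI, rule ccontr)
    fix v assume v: "v \<in> verts G" and neg: "\<not> (\<exists>z\<in>R. (v, z) \<in> reach F)"
    define W where "W = reach F `` {v}"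
    have "W \<subseteq> verts G - R"
      using adj_rtrancl_verts[of v _ "spanning_subgraph G F"] v neg by (auto simp: W_def)
    moreover have "v \<in> W" by (simp add: W_def)
    ultimately obtain e where e: "e \<in> F" "crosses (ends G e) W"
      using groundedD[OF g, of W] by blast
    from e(2) obtain x y where xy: "ends G e = Upair x y" "x \<in> W" "y \<notin> W" by (rule crossesE)
    have "(x, y) \<in> adj (spanning_subgraph G F)" by (rule edge_reach[OF assms e(1) xy(1)])
    then have "y \<in> W" using xy(2) unfolding W_def by (auto intro: rtrancl_into_rtrancl)
    then show False using xy(3) by simp
  qed
next
  assume r: "\<forall>v\<in>verts G. \<exists>z\<in>R. (v, z) \<in> reach F"
  show "grounded (ends G) F (verts G - R)"
  proof (rule groundedI)
    fix W assume W: "W \<subseteq> verts G - R" "W \<noteq> {}"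
    then obtain v z where "v \<in> W" "z \<in> R" "(v, z) \<in> reach F" using r by blast
    moreover have "z \<notin> W" using \<open>z \<in> R\<close> W by blast
    ultimately obtain x y where "(x, y) \<in> adj (spanning_subgraph G F)" "x \<in> W" "y \<notin> W"
      using rtrancl_leaves_set[of v z _ W] by metis
    then obtain e where "e \<in> F" "ends G e = Upair x y" "x \<in> W" "y \<notin> W"
      by (auto simp: adj_spanning_subgraph)
    then show "\<exists>e\<in>F. crosses (ends G e) W" by (intro bexI[of _ e]) auto
  qed
qed

text \<open>A simple path from \<open>x\<close> to \<open>y\<close> avoiding \<open>e\<close> is
  closed by \<open>e\<close>. If \<open>e\<close> is a loop, the path has length 0 and the cycle
  consists of \<open>e\<close> alone.\<close>

lemma is_cycle_if_reach:
  assumes "F \<subseteq> edges G" "e \<in> F" "ends G e = Upair x y" "(x, y) \<in> reach (F - {e})"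
  shows "\<not> acyclic_graph (spanning_subgraph G F)"
proof -
  obtain n f where f: "f 0 = x" "f n = y" "inj_on f {..n}"
    and step: "\<And>i. i < n \<Longrightarrow> (f i, f (Suc i)) \<in> adj (spanning_subgraph G (F - {e}))"
    using rtrancl_simple_path[OF assms(4)] by metis
  have "\<forall>i. \<exists>g. i < n \<longrightarrow> g \<in> F - {e} \<and> ends G g = Upair (f i) (f (Suc i))"
    using step by (auto simp: adj_spanning_subgraph)
  then obtain g where g: "\<And>i. i < n \<Longrightarrow> g i \<in> F - {e}"
    "\<And>i. i < n \<Longrightarrow> ends G (g i) = Upair (f i) (f (Suc i))" by metis
  have f_eq: "f i = f j \<longleftrightarrow> i = j" if "i \<le> n" "j \<le> n" for i j
    using f(3) that by (auto simp: inj_on_def)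
  have "inj_on g {..<n}"
  proof (rule inj_onI)
    fix i j assume ij: "i \<in> {..<n}" "j \<in> {..<n}" "g i = g j"
    then have "Upair (f i) (f (Suc i)) = Upair (f j) (f (Suc j))" using g(2) by (metis lessThan_iff)
    \<comment> \<open>Otherwise the edge would be used in opposite directions, so that
      \<open>i = Suc j\<close> and \<open>j = Suc i\<close>.\<close>
    then show "i = j" using ij f_eq by auto
  qed
  have verts: "f i \<in> verts G" if "i \<le> n" for i
  proof (cases "i = 0")
    case True
    then show ?thesis using ends_verts[of e] assms(1-3) f(1) by auto
  next
    case False
    then obtain j where "i = Suc j" "j < n" using \<open>i \<le> n\<close> by (cases i) auto
    then show ?thesis using step[of j] by (simp add: adj_spanning_subgraph)
  qed
  let ?vs = "map f [0..<Suc n]" and ?es = "map g [0..<n] @ [e]"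
  have "is_cycle (spanning_subgraph G F) ?vs ?es"
    unfolding is_cycle_def
  proof (intro conjI allI impI)
    show "distinct ?vs"
      using f(3) unfolding distinct_map by (auto simp: inj_on_def)
    show "distinct ?es"
      using \<open>inj_on g {..<n}\<close> g(1) by (auto simp: distinct_map atLeast0LessThan)
    show "set ?vs \<subseteq> verts (spanning_subgraph G F)" using verts by auto
    show "set ?es \<subseteq> edges (spanning_subgraph G F)" using g(1) assms(2) by auto
    fix i assume i: "i < length ?es"
    show "ends (spanning_subgraph G F) (?es ! i) = Upair (?vs ! i) (?vs ! (Suc i mod length ?vs))"
    proof (cases "i < n")
      case True
      then show ?thesis using g(2)[of i] by (simp add: nth_append del: upt_Suc)
    next
      case False
      then have "i = n" using i by simp
      then show ?thesis using f assms(3) by (simp add: nth_append Upair_inject del: upt_Suc)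
    qed
  qed simp_all
  then show ?thesis unfolding acyclic_graph_def by blast
qed

text \<open>The last edge of a cycle is bypassed by the others, which avoid it because the edges of
  a cycle are distinct.\<close>

lemma reach_if_is_cycle:
  assumes "\<not> acyclic_graph (spanning_subgraph G F)"
  obtains e x y where "e \<in> F" "ends G e = Upair x y" "(x, y) \<in> reach (F - {e})"
proof -
  obtain vs es where c: "is_cycle (spanning_subgraph G F) vs es"
    using assms by (auto simp: acyclic_graph_def)
  define n where "n = length es - 1"
  have len: "length es = Suc n" "length vs = Suc n" and d: "distinct es"
    and vs: "set vs \<subseteq> verts G" and es: "set es \<subseteq> F"
    and step: "\<And>i. i < Suc n \<Longrightarrow> ends G (es ! i) = Upair (vs ! i) (vs ! (Suc i mod Suc n))"
    using c unfolding is_cycle_def n_def by (auto simp: Suc_diff_1 length_greater_0_conv)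
  have path: "(vs ! 0, vs ! i) \<in> reach (F - {es ! n})" if "i \<le> n" for i
    using that
  proof (induction i)
    case (Suc i)
    have "es ! i \<in> F - {es ! n}"
      using d es len Suc.prems by (auto simp: nth_eq_iff_index_eq)
    moreover have "ends G (es ! i) = Upair (vs ! i) (vs ! Suc i)"
      using step[of i] Suc.prems by simp
    moreover have "vs ! i \<in> verts G" "vs ! Suc i \<in> verts G"
      using vs len Suc.prems by (auto intro!: subsetD[OF vs] nth_mem)
    ultimately have "(vs ! i, vs ! Suc i) \<in> adj (spanning_subgraph G (F - {es ! n}))"
      unfolding adj_spanning_subgraph by blast
    moreover have "(vs ! 0, vs ! i) \<in> reach (F - {es ! n})" using Suc by simp
    ultimately show ?case by (rule rtrancl_into_rtrancl[rotated])
  qed simp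
  have "(vs ! n, vs ! 0) \<in> reach (F - {es ! n})"
    by (rule adj_rtrancl_sym[OF path[OF order_refl]])
  moreover have "ends G (es ! n) = Upair (vs ! n) (vs ! 0)" using step[of n] by simp
  moreover have "es ! n \<in> F" using es len by auto
  ultimately show thesis using that by blast
qed

lemma reach_remove_edge:
  assumes "ends G e = Upair x y" "(x, y) \<in> reach (F - {e})"
  shows "reach F \<subseteq> reach (F - {e})"
proof (rule rtrancl_subset_rtrancl, rule subrelI)
  fix u v assume "(u, v) \<in> adj (spanning_subgraph G F)"
  then obtain e' where e': "u \<in> verts G" "v \<in> verts G" "e' \<in> F" "ends G e' = Upair u v"
    by (auto simp: adj_spanning_subgraph)
  show "(u, v) \<in> reach (F - {e})"
  proof (cases "e' = e")
    case True
    then have "u = x \<and> v = y \<or> u = y \<and> v = x" using e' assms(1) by auto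
    then show ?thesis using assms(2) adj_rtrancl_sym[OF assms(2)] by auto
  next
    case False
    then have "(u, v) \<in> adj (spanning_subgraph G (F - {e}))"
      using e' by (auto simp: adj_spanning_subgraph)
    then show ?thesis by blast
  qed
qed

text \<open>An edge on a cycle could be dropped, against minimality. If a component had two roots,
  one of them could become a non-root, and \<open>F\<close> would ground one vertex more than it has
  edges.\<close>

lemma ground_forests_subset_rooted:
  assumes R: "R \<subseteq> verts G" and F: "F \<in> ground_forests (ends G) (edges G) (verts G - R)"
  shows "F \<in> rooted_spanning_forests G R"
proof -
  have FE: "F \<subseteq> edges G" and g: "grounded (ends G) F (verts G - R)"
    and card: "card F = card (verts G - R)"
    using F by (auto simp: ground_forests_def)
  have fin: "finite F" using FE finite_edges finite_subset by blast
  have reach: "\<exists>z\<in>R. (v, z) \<in> reach F" if "v \<in> verts G" for v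
    using g that unfolding grounded_iff_reach[OF FE] by blast
  have "acyclic_graph (spanning_subgraph G F)"
  proof (rule ccontr)
    assume "\<not> ?thesis"
    then obtain e x y where e: "e \<in> F" "ends G e = Upair x y" "(x, y) \<in> reach (F - {e})"
      by (rule reach_if_is_cycle)
    have "F - {e} \<subseteq> edges G" using FE by blast
    then have "grounded (ends G) (F - {e}) (verts G - R)"
      unfolding grounded_iff_reach[OF \<open>F - {e} \<subseteq> edges G\<close>]
      using reach reach_remove_edge[OF e(2,3)] by blast
    then show False
      using ground_forests_minimal[OF finite_edges _ F e(1)] finite_verts by simp
  qed
  moreover have "\<exists>!z. z \<in> C \<and> z \<in> R" if C: "C \<in> components (spanning_subgraph G F)" for C
  proof -
    obtain v where v: "v \<in> verts G" "C = reach F `` {v}"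
      using C by (auto simp: in_components)
    obtain z where z: "z \<in> R" "(v, z) \<in> reach F" using reach[OF v(1)] by blast
    have "z' = z" if z': "z' \<in> R" "(v, z') \<in> reach F" for z'
    proof (rule ccontr)
      assume ne: "z' \<noteq> z"
      have zz: "(z', z) \<in> reach F"
        using adj_rtrancl_sym[OF z'(2)] z(2) by (rule rtrancl_trans)
      have "\<exists>y\<in>R - {z'}. (u, y) \<in> reach F" if u: "u \<in> verts G" for u
      proof -
        obtain y where y: "y \<in> R" "(u, y) \<in> reach F" using reach[OF u] by blast
        show ?thesis
        proof (cases "y = z'")
          case True
          then have "(u, z) \<in> reach F" using y(2) zz by (blast intro: rtrancl_trans)
          then show ?thesis using z(1) ne by blast
        qed (use y in blast)
      qed
      then have "grounded (ends G) F (verts G - (R - {z'}))"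
        unfolding grounded_iff_reach[OF FE] by blast
      then have "card (verts G - (R - {z'})) \<le> card F"
        using grounded_card_le finite_verts fin by blast
      moreover have "verts G - (R - {z'}) = insert z' (verts G - R)"
        using R z'(1) by blast
      moreover have "card (insert z' (verts G - R)) = Suc (card (verts G - R))"
        using finite_verts z'(1) by (intro card_insert_disjoint) auto
      ultimately show False using card by simp
    qed
    then show ?thesis using z v(2) by blast
  qed
  ultimately show ?thesis using FE by (simp add: rooted_spanning_forests_def)
qed

text \<open>Choose a grounded subset \<open>F'\<close> of the right size. The ends of an edge
  \<open>e\<close> in \<open>F\<close> but not in \<open>F'\<close> reach roots within
  \<open>F'\<close>; these coincide, because \<open>e\<close> puts them into one component of
  \<open>F\<close>. So \<open>e\<close> would close a cycle.\<close>

lemma rooted_subset_ground_forests: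
  assumes "F \<in> rooted_spanning_forests G R"
  shows "F \<in> ground_forests (ends G) (edges G) (verts G - R)"
proof -
  have FE: "F \<subseteq> edges G" and ac: "acyclic_graph (spanning_subgraph G F)"
    and uniq: "\<And>C. C \<in> components (spanning_subgraph G F) \<Longrightarrow> \<exists>!z. z \<in> C \<and> z \<in> R"
    using assms by (auto simp: rooted_spanning_forests_def)
  have fin: "finite F" using FE finite_edges finite_subset by blast
  have comp: "reach F `` {v} \<in> components (spanning_subgraph G F)" if "v \<in> verts G" for v
    using that by (auto simp: in_components)
  have g: "grounded (ends G) F (verts G - R)"
    unfolding grounded_iff_reach[OF FE] using uniq[OF comp] by blast
  obtain F' where F': "F' \<subseteq> F" "grounded (ends G) F' (verts G - R)" "card F' = card (verts G - R)"
    using grounded_subset_card[OF _ g fin] finite_verts by auto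
  have F'E: "F' \<subseteq> edges G" using F' FE by blast
  have "F \<subseteq> F'"
  proof
    fix e assume e: "e \<in> F"
    show "e \<in> F'"
    proof (rule ccontr)
      assume "e \<notin> F'"
      obtain x y where xy: "ends G e = Upair x y" by (cases "ends G e") auto
      have V: "x \<in> verts G" "y \<in> verts G" using ends_verts[of e] e FE xy by auto
      obtain z1 z2 where z: "z1 \<in> R" "(x, z1) \<in> reach F'" "z2 \<in> R" "(y, z2) \<in> reach F'"
        using F'(2) V unfolding grounded_iff_reach[OF F'E] by blast
      have "(x, z1) \<in> reach F" "(y, z2) \<in> reach F"
        using z adj_rtrancl_mono[OF F'(1)] by blast+
      moreover have "(x, y) \<in> reach F" using edge_reach[OF FE e xy] by blast
      ultimately have "z1 \<in> reach F `` {x}" "z2 \<in> reach F `` {x}"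
        by (auto intro: rtrancl_trans)
      then have "z1 = z2" using uniq[OF comp[OF V(1)]] z(1,3) by blast
      then have "(x, y) \<in> reach F'" using z(2) adj_rtrancl_sym[OF z(4)] by (auto intro: rtrancl_trans)
      moreover have "F' \<subseteq> F - {e}" using F'(1) \<open>e \<notin> F'\<close> by blast
      ultimately have "(x, y) \<in> reach (F - {e})" using adj_rtrancl_mono by blast
      then show False using is_cycle_if_reach[OF FE e xy] ac by blast
    qed
  qed
  then have "F = F'" using F'(1) by blast
  then show ?thesis using F' FE by (simp add: ground_forests_def)
qed

lemma rooted_spanning_forests_eq_ground_forests:
  assumes "R \<subseteq> verts G"
  shows "rooted_spanning_forests G R = ground_forests (ends G) (edges G) (verts G - R)"
  using ground_forests_subset_rooted[OF assms] rooted_subset_ground_forests by blast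

lemma spanning_trees_eq_rooted_spanning_forests:
  assumes "x \<in> verts G"
  shows "spanning_trees G = rooted_spanning_forests G {x}"
proof -
  have "connected_graph (spanning_subgraph G F) \<longleftrightarrow>
      (\<forall>C\<in>components (spanning_subgraph G F). \<exists>!v. v \<in> C \<and> v \<in> {x})" (is "?L \<longleftrightarrow> ?R") for F
  proof
    assume ?L
    have "x \<in> C" if "C \<in> components (spanning_subgraph G F)" for C
      using that assms \<open>?L\<close> unfolding connected_graph_def in_components by auto
    then show ?R by auto
  next
    assume ?R
    have x: "(v, x) \<in> reach F" if v: "v \<in> verts G" for v
    proof -
      have "reach F `` {v} \<in> components (spanning_subgraph G F)"
        using v by (auto simp: in_components)
      then have "\<exists>!u. u \<in> reach F `` {v} \<and> u \<in> {x}" using \<open>?R\<close> by blast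
      then show ?thesis by auto
    qed
    have "(u, v) \<in> reach F" if "u \<in> verts G" "v \<in> verts G" for u v
      using x[OF that(1)] adj_rtrancl_sym[OF x[OF that(2)]] by (rule rtrancl_trans)
    then show ?L using assms by (auto simp: connected_graph_def)
  qed
  then show ?thesis by (auto simp: spanning_trees_def rooted_spanning_forests_def)
qed

lemma finite_mgraph_identify: "finite_mgraph (identify G R)"
proof
  show "finite (verts (identify G R))" "finite (edges (identify G R))"
    using finite_verts finite_edges by (simp_all add: identify_def)
  show "set_uprod (ends (identify G R) e) \<subseteq> verts (identify G R)"
    if "e \<in> edges (identify G R)" for e
    using that ends_verts[of e] by (auto simp: identify_def uprod.set_map)
qed

lemma spanning_trees_identify:
  assumes "R \<subseteq> verts G" "R \<noteq> {}"
  shows "spanning_trees (identify G R) = rooted_spanning_forests G R"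
proof -
  interpret I: finite_mgraph "identify G R" by (rule finite_mgraph_identify)
  define U where "U = verts G - R"
  define t' where "t' = (\<lambda>e. map_uprod (merge R) (ends G e))"
  have finU: "finite U" using finite_verts by (simp add: U_def)
  have "None \<in> verts (identify G R)" using assms by (auto simp: identify_def merge_def)
  then have "spanning_trees (identify G R) =
      ground_forests (ends (identify G R)) (edges (identify G R)) (verts (identify G R) - {None})"
    by (simp add: I.spanning_trees_eq_rooted_spanning_forests
        I.rooted_spanning_forests_eq_ground_forests)
  also have "verts (identify G R) - {None} = Some ` U"
    by (auto simp: identify_def merge_def U_def)
  also have "ends (identify G R) = t'" by (simp add: identify_def t'_def)
  also have "edges (identify G R) = {e \<in> edges G. proper_uprod (t' e)}"
    by (simp add: identify_def t'_def)
  \<comment> \<open>Loops cross no cut, so by minimality no forest contains one and deleting them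
    changes nothing.\<close>
  also have "ground_forests t' {e \<in> edges G. proper_uprod (t' e)} (Some ` U) =
      ground_forests t' (edges G) (Some ` U)"
  proof (intro equalityI subsetI)
    fix F assume F: "F \<in> ground_forests t' (edges G) (Some ` U)"
    have "proper_uprod (t' e)" if e: "e \<in> F" for e
    proof (rule ccontr)
      assume np: "\<not> proper_uprod (t' e)"
      have nc: "\<not> crosses (t' e) W" for W
        using np by (cases "t' e") auto
      have "grounded t' (F - {e}) (Some ` U)"
        using F nc unfolding ground_forests_def grounded_def by blast
      then show False using ground_forests_minimal[OF finite_edges _ F e] finU by simp
    qed
    then show "F \<in> ground_forests t' {e \<in> edges G. proper_uprod (t' e)} (Some ` U)"
      using F by (auto simp: ground_forests_def)
  qed (auto simp: ground_forests_def)
  also have "\<dots> = ground_forests (ends G) (edges G) U"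
  proof -
    \<comment> \<open>Cuts contain no vertex of \<open>R\<close>, hence \<open>merge R\<close>
      neither moves a vertex into the image of a cut nor out of it.\<close>
    have "crosses (t' e) (Some ` W) \<longleftrightarrow> crosses (ends G e) W" if "W \<subseteq> U" for e W
    proof -
      have "merge R x \<in> Some ` W \<longleftrightarrow> x \<in> W" for x
        using that by (auto simp: merge_def U_def)
      then show ?thesis unfolding t'_def by (cases "ends G e") simp
    qed
    then have "grounded t' F (Some ` U) \<longleftrightarrow> grounded (ends G) F U" for F
      unfolding grounded_def by (simp add: all_subset_image)
    then show ?thesis by (simp add: ground_forests_def card_image)
  qed
  also have "\<dots> = rooted_spanning_forests G R"
    using rooted_spanning_forests_eq_ground_forests[OF assms(1)] by (simp add: U_def)
  finally show ?thesis .
qed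

end

section \<open>Fans\<close>

lemma lucas_eq_fib: "lucas (Suc n) = fib n + fib (Suc (Suc n))"
  by (induction n rule: fib.induct) simp_all

text \<open>\<open>Inl k\<close> labels the \<open>k\<close>-th edge of the walk \<open>w\<close> and \<open>Inr k\<close> the spoke at \<open>w k\<close>.\<close>

fun fan_ends :: "(nat \<Rightarrow> 'v) \<Rightarrow> 'v \<Rightarrow> nat + nat \<Rightarrow> 'v uprod" where
  "fan_ends w c (Inl k) = Upair (w k) (w (Suc k))"
| "fan_ends w c (Inr k) = Upair c (w k)"

text \<open>No vertex of the walk \<open>w i, \<dots>, w (k + 1)\<close> other than possibly its two ends repeats; the
  interior vertices are \<open>w (i + 1), \<dots>, w k\<close>.\<close>

definition simple_interior :: "(nat \<Rightarrow> 'v) \<Rightarrow> nat \<Rightarrow> nat \<Rightarrow> bool" where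
  "simple_interior w i k \<longleftrightarrow> (\<forall>j\<in>{i..Suc k}. \<forall>l\<in>{Suc i..k}. w j = w l \<longrightarrow> j = l)"

lemma simple_interiorD:
  "simple_interior w i k \<Longrightarrow> i \<le> j \<Longrightarrow> j \<le> Suc k \<Longrightarrow> i < l \<Longrightarrow> l \<le> k \<Longrightarrow> w j = w l \<Longrightarrow> j = l"
  by (simp add: simple_interior_def)

lemma simple_interior_left: "simple_interior w i k \<Longrightarrow> simple_interior w (Suc i) k"
  and simple_interior_right: "simple_interior w i (Suc k) \<Longrightarrow> simple_interior w i k"
  by (auto simp: simple_interior_def)

locale fan =
  fixes w :: "nat \<Rightarrow> 'v" and c :: 'v
  assumes center: "w k \<noteq> c"
begin

abbreviation num :: "(nat + nat) set \<Rightarrow> 'v set \<Rightarrow> nat" where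
  "num \<equiv> num_ground_forests (fan_ends w c)"

text \<open>The ends \<open>w i\<close> and \<open>w (k + 1)\<close> are roots. Both of them are attached to the interior in
  \<open>full_fan\<close>, only \<open>w (k + 1)\<close> in \<open>half_fan\<close>; \<open>block\<close> also has the spoke at \<open>w i\<close>.\<close>

definition interior :: "nat \<Rightarrow> nat \<Rightarrow> 'v set" where
  "interior i k = w ` {Suc i..k}"

definition half_fan :: "nat \<Rightarrow> nat \<Rightarrow> (nat + nat) set" where
  "half_fan i k = Inl ` {Suc i..k} \<union> Inr ` {Suc i..k}"

definition full_fan :: "nat \<Rightarrow> nat \<Rightarrow> (nat + nat) set" where
  "full_fan i k = Inl ` {i..k} \<union> Inr ` {Suc i..k}"

definition block :: "nat \<Rightarrow> nat \<Rightarrow> (nat + nat) set" where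
  "block i k = Inl ` {i..k} \<union> Inr ` {i..k}"

section \<open>Peeling fans and counting their forests\<close>

lemma finite_fans [simp]:
  "finite (interior i k)" "finite (half_fan i k)" "finite (full_fan i k)"
  by (simp_all add: interior_def half_fan_def full_fan_def)

lemma center_notin_interior [simp]: "c \<notin> interior i k"
  using center by (auto simp: interior_def)

lemma notin_interior:
  assumes "simple_interior w i k" "i \<le> i'" "k' \<le> k" "i \<le> j" "j \<le> Suc k" "j \<le> i' \<or> k' < j"
  shows "w j \<notin> interior i' k'"
proof
  assume "w j \<in> interior i' k'"
  then obtain l where "i' < l" "l \<le> k'" "w j = w l" by (auto simp: interior_def Suc_le_eq)
  then show False using simple_interiorD[OF assms(1), of j l] assms(2-6) by auto
qed

lemma base [simp]: "interior i i = {}" "half_fan i i = {}" "full_fan i i = {Inl i}"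
  by (simp_all add: interior_def half_fan_def full_fan_def)

text \<open>Peeling single edges from the left alternates between full and half fans;
  \<open>half_fan_Suc\<close> peels at the right, next to the end that a half fan keeps
  attached.\<close>

lemma full_fan_eq: "i \<le> k \<Longrightarrow> full_fan i k = insert (Inl i) (half_fan i k)"
  by (auto simp: full_fan_def half_fan_def)

lemma half_fan_eq: "i < k \<Longrightarrow> half_fan i k = insert (Inr (Suc i)) (full_fan (Suc i) k)"
  by (auto simp: full_fan_def half_fan_def)

lemma half_fan_Suc:
  "i \<le> k \<Longrightarrow> half_fan i (Suc k) = insert (Inl (Suc k)) (insert (Inr (Suc k)) (half_fan i k))"
  by (simp add: half_fan_def atLeastAtMostSuc_conv insert_commute)

lemma block_eq: "i \<le> k \<Longrightarrow> block i k = insert (Inr i) (full_fan i k)"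
  by (auto simp: block_def full_fan_def)

lemma interior_left:
  assumes "simple_interior w i k" "i < k"
  shows "w (Suc i) \<in> interior i k" "interior i k - {w (Suc i)} = interior (Suc i) k"
    "w (Suc i) \<notin> interior (Suc i) k"
proof -
  show n: "w (Suc i) \<notin> interior (Suc i) k"
    by (rule notin_interior[OF assms(1)]) (use assms(2) in auto)
  have "{Suc i..k} = insert (Suc i) {Suc (Suc i)..k}" using assms(2) by auto
  then show "w (Suc i) \<in> interior i k" "interior i k - {w (Suc i)} = interior (Suc i) k"
    using n by (auto simp: interior_def)
qed

lemma interior_right:
  assumes "simple_interior w i (Suc k)" "i \<le> k"
  shows "w (Suc k) \<in> interior i (Suc k)" "interior i (Suc k) - {w (Suc k)} = interior i k"
proof -
  have n: "w (Suc k) \<notin> interior i k"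
    by (rule notin_interior[OF assms(1)]) (use assms(2) in auto)
  have "{Suc i..Suc k} = insert (Suc k) {Suc i..k}" using assms(2) by auto
  then show "w (Suc k) \<in> interior i (Suc k)" "interior i (Suc k) - {w (Suc k)} = interior i k"
    using n by (auto simp: interior_def)
qed

lemma interior_ends:
  assumes "simple_interior w i k" "i \<le> k"
  shows "w i \<notin> interior i k" "w (Suc k) \<notin> interior i k"
  by (rule notin_interior[OF assms(1)]; use assms(2) in simp)+

text \<open>In the half fan, the first spoke is absent, leaving a half fan one shorter, or present,
  leaving a full fan one shorter. In the full fan, the first rim edge is absent, leaving the half
  fan of the same length, or present, leaving a full fan one shorter. So the two counts interleave
  to a single Fibonacci sequence.\<close>

lemma num_fans_rooted_center:
  assumes "simple_interior w i (i + m)"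
  shows "num (full_fan i (i + m)) (interior i (i + m)) = fib (2 * m + 2) \<and>
    num (half_fan i (i + m)) (interior i (i + m)) = fib (2 * m + 1)"
  using assms
proof (induction m arbitrary: i)
  case 0
  have "num {Inl i} {} = 1" "num {} {} = 1" by simp_all
  then show ?case by (simp add: numeral_2_eq_2)
next
  case (Suc m)
  define k where "k = i + Suc m"
  have k: "Suc i + m = k" "i + Suc m = k" "i < k" by (simp_all add: k_def)
  have s: "simple_interior w i k" using Suc.prems k by simp
  note IH = Suc.IH[of "Suc i", unfolded k(1), OF simple_interior_left[OF s]]
  note left = interior_left[OF s k(3)]
  have "num (half_fan i k) (interior i k) =
      num (full_fan (Suc i) k) (interior i k) + num (full_fan (Suc i) k) (interior i k - {w (Suc i)})"
    unfolding half_fan_eq[OF k(3)]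
    by (rule num_ground_forests_crossing[where x = c]) (use left in \<open>simp_all add: full_fan_def image_iff\<close>)
  \<comment> \<open>Without its spoke, \<open>w (Suc i)\<close> hangs on the rim edge to its right,
    which is thus forced.\<close>
  also have "num (full_fan (Suc i) k) (interior i k) =
      num (half_fan (Suc i) k) (interior i k - {w (Suc i)})"
  proof -
    have ne: "w j \<noteq> w (Suc i)" if "Suc i < j" "j \<le> Suc k" for j
      using simple_interiorD[OF s, of j "Suc i"] that k(3) by auto
    have "Suc i \<le> k" using k(3) by simp
    then show ?thesis
      unfolding full_fan_eq[OF \<open>Suc i \<le> k\<close>]
    proof (intro num_ground_forests_leaf[where x = "w (Suc (Suc i))"])
      fix e assume "e \<in> half_fan (Suc i) k"
      then consider j where "e = Inl j" "Suc i < j" "j \<le> k" | j where "e = Inr j" "Suc i < j" "j \<le> k"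
        by (auto simp: half_fan_def Suc_le_eq)
      then show "w (Suc i) \<notin> set_uprod (fan_ends w c e)"
      proof cases
        case (1 j)
        then show ?thesis using ne[of j] ne[of "Suc j"] by simp
      next
        case (2 j)
        then show ?thesis using ne[of j] center[of "Suc i"] by simp
      qed
    qed (use left k(3) ne[of "Suc (Suc i)"] in \<open>simp_all add: half_fan_def image_iff\<close>)
  qed
  finally have half: "num (half_fan i k) (interior i k) = fib (2 * Suc m + 1)"
    using left(2) IH by simp
  have "num (full_fan i k) (interior i k) =
      num (half_fan i k) (interior i k) + num (half_fan i k) (interior i k - {w (Suc i)})"
    unfolding full_fan_eq[OF less_imp_le[OF k(3)]]
    by (rule num_ground_forests_crossing[where x = "w i"])
      (use left interior_ends[OF s less_imp_le[OF k(3)]] in \<open>simp_all add: half_fan_def image_iff\<close>)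
  also have "num (half_fan i k) (interior i k - {w (Suc i)}) =
      num (full_fan (Suc i) k) (interior (Suc i) k)"
    unfolding left(2) half_fan_eq[OF k(3)]
    by (rule num_ground_forests_outside) (use left in auto)
  finally show ?case using half IH k(2) by simp
qed

text \<open>Only the last rim edge leads to a root, so it is forced. The spoke at the root it
  creates is then absent, leaving the centre free, or present, making the centre a root. This is the
  classical number of spanning trees of a fan with \<open>m\<close> path vertices, as the forced
  edge is pendant.\<close>

lemma num_half_fan_free_center:
  assumes "simple_interior w i (i + m)"
  shows "num (half_fan i (i + m)) (insert c (interior i (i + m))) = fib (2 * m)"
  using assms
proof (induction m)
  case 0
  have "num {} {c} = 0" by (rule num_ground_forests_eq_0) auto
  then show ?case by simp
next
  case (Suc m)
  define k where "k = i + m"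
  have s: "simple_interior w i (Suc k)" and ik: "i \<le> k" using Suc.prems by (simp_all add: k_def)
  note s' = simple_interior_right[OF s]
  note right = interior_right[OF s ik] and out = interior_ends[OF s le_SucI[OF ik]]
  let ?E = "insert (Inr (Suc k)) (half_fan i k)" and ?U = "insert c (interior i (Suc k))"
  have U: "?U - {w (Suc k)} = insert c (interior i k)" using right center[of "Suc k"] by auto
  have "num (half_fan i (Suc k)) ?U = num ?E ?U + num ?E (?U - {w (Suc k)})"
    unfolding half_fan_Suc[OF ik]
    by (rule num_ground_forests_crossing[where x = "w (Suc (Suc k))"])
      (use right out center in \<open>simp_all add: half_fan_def image_iff\<close>)
  also have "num ?E ?U = 0"
    by (rule num_ground_forests_eq_0) (use ik in \<open>auto simp: half_fan_def interior_def\<close>)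
  also have "num ?E (?U - {w (Suc k)}) =
      num (half_fan i k) (insert c (interior i k)) + num (half_fan i k) (insert c (interior i k) - {c})"
    unfolding U
    by (rule num_ground_forests_crossing[where x = "w (Suc k)"])
      (use center[of "Suc k"] interior_ends[OF s' ik] in \<open>simp_all add: half_fan_def image_iff\<close>)
  also have "insert c (interior i k) - {c} = interior i k" by simp
  finally show ?case
    using Suc.IH num_fans_rooted_center[of i m] s' by (simp add: k_def)
qed

text \<open>Peeling the first rim edge and then the first spoke shows that the count grows by 2
  F_(2m+2) from \<open>m\<close> to \<open>m + 1\<close>. The offset 2 comes from
  \<open>m = 0\<close>, where the centre has no edge and the count is 0; it stands on the left to
  avoid truncated subtraction.\<close>

lemma num_full_fan_free_center:
  assumes "simple_interior w i (i + m)"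
  shows "num (full_fan i (i + m)) (insert c (interior i (i + m))) + 2 = 2 * fib (2 * m + 1)"
  using assms
proof (induction m arbitrary: i)
  case 0
  have "num {} {c} = 0" by (rule num_ground_forests_eq_0) auto
  moreover have "num {Inl i} {c} = num {} {c}"
    by (rule num_ground_forests_outside) (use center in auto)
  ultimately show ?case by simp
next
  case (Suc m)
  define k where "k = i + Suc m"
  have k: "Suc i + m = k" "i + Suc m = k" "i < k" by (simp_all add: k_def)
  have s: "simple_interior w i k" using Suc.prems k by simp
  note s' = simple_interior_left[OF s]
  note IH = Suc.IH[of "Suc i", unfolded k(1), OF s']
  note left = interior_left[OF s k(3)]
  let ?U = "insert c (interior i k)"
  have U: "?U - {w (Suc i)} = insert c (interior (Suc i) k)" using left center[of "Suc i"] by auto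
  have "num (full_fan i k) ?U = num (half_fan i k) ?U + num (half_fan i k) (?U - {w (Suc i)})"
    unfolding full_fan_eq[OF less_imp_le[OF k(3)]]
    by (rule num_ground_forests_crossing[where x = "w i"])
      (use left interior_ends[OF s less_imp_le[OF k(3)]] center in \<open>simp_all add: half_fan_def image_iff\<close>)
  also have "num (half_fan i k) (?U - {w (Suc i)}) =
      num (full_fan (Suc i) k) (insert c (interior (Suc i) k)) +
      num (full_fan (Suc i) k) (insert c (interior (Suc i) k) - {c})"
    unfolding U half_fan_eq[OF k(3)]
    by (rule num_ground_forests_crossing[where x = "w (Suc i)"])
      (use left center in \<open>simp_all add: full_fan_def image_iff\<close>)
  also have "insert c (interior (Suc i) k) - {c} = interior (Suc i) k" by simp
  finally show ?case
    using IH num_fans_rooted_center[of "Suc i" m] num_half_fan_free_center[of i "Suc m"] s s' k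
    by simp
qed

lemma num_block:
  assumes "simple_interior w i (i + m)"
  shows "num (block i (i + m)) (interior i (i + m)) = fib (2 * Suc m)"
    and "num (block i (i + m)) (insert c (interior i (i + m))) = lucas (2 * Suc m) - 2"
proof -
  let ?k = "i + m"
  have "num (block i ?k) (interior i ?k) = num (full_fan i ?k) (interior i ?k)"
    unfolding block_eq[OF le_add1]
    by (rule num_ground_forests_outside) (use interior_ends[OF assms le_add1] in auto)
  then show "num (block i ?k) (interior i ?k) = fib (2 * Suc m)"
    using num_fans_rooted_center[OF assms] by simp
  have "num (block i ?k) (insert c (interior i ?k)) =
      num (full_fan i ?k) (insert c (interior i ?k)) + num (full_fan i ?k) (insert c (interior i ?k) - {c})"
    unfolding block_eq[OF le_add1]
    by (rule num_ground_forests_crossing[where x = "w i"])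
      (use interior_ends[OF assms le_add1] center in \<open>simp_all add: full_fan_def image_iff\<close>)
  also have "insert c (interior i ?k) - {c} = interior i ?k" by simp
  finally show "num (block i ?k) (insert c (interior i ?k)) = lucas (2 * Suc m) - 2"
    using num_fans_rooted_center[OF assms] num_full_fan_free_center[OF assms]
    by (simp add: lucas_eq_fib)
qed

text \<open>Multiples of \<open>q\<close> are the positions of the roots. \<open>sep\<close> lets
  only these coincide on the walk, as the two ends of a closed walk do. At \<open>n = 0\<close> the
  truncated exponent is harmless because of the factor \<open>n\<close>.\<close>

lemma num_blocks:
  assumes "q > 0" "n \<le> r"
    and sep: "\<And>j l. j \<le> r * q \<Longrightarrow> l < r * q \<Longrightarrow> \<not> q dvd l \<Longrightarrow> w j = w l \<Longrightarrow> j = l"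
  defines "E \<equiv> \<lambda>n. Inl ` {..<n * q} \<union> Inr ` {..<n * q}"
    and "U \<equiv> \<lambda>n. w ` {j. j < n * q \<and> \<not> q dvd j}"
  shows "num (E n) (U n) = fib (2 * q) ^ n \<and>
    num (E n) (insert c (U n)) = n * (lucas (2 * q) - 2) * fib (2 * q) ^ (n - 1)"
  using assms(2)
proof (induction n)
  case 0
  have "num {} {c} = 0" by (rule num_ground_forests_eq_0) auto
  then show ?case by (simp add: E_def U_def)
next
  case (Suc n)
  obtain m where m: "q = Suc m" using assms(1) by (cases q) auto
  let ?i = "n * q"
  let ?k = "?i + m"
  let ?B = "block ?i ?k" and ?P = "interior ?i ?k"
  have "Suc n * q \<le> r * q" using Suc.prems by (rule mult_le_mono1)
  then have le: "?i + q \<le> r * q" by simp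
  have nd: "\<not> q dvd l" if "?i < l" "l \<le> ?k" for l
  proof
    assume "q dvd l"
    then obtain d where "l = q * d" by blast
    then have "q * n < q * d" "q * d < q * Suc n" using that m by (simp_all add: mult.commute)
    then have "n < d" "d < Suc n" by (simp_all only: mult_less_cancel1)
    then show False by simp
  qed
  have s: "simple_interior w ?i ?k"
    unfolding simple_interior_def using sep nd le m by fastforce
  have center': "c \<notin> U n" using center by (auto simp: U_def)
  have E: "E (Suc n) = E n \<union> ?B"
    using m by (auto simp: E_def block_def image_iff)
  have "{j. j < Suc n * q \<and> \<not> q dvd j} = {j. j < ?i \<and> \<not> q dvd j} \<union> {Suc ?i..?k}"
  proof (intro equalityI subsetI)
    fix j assume j: "j \<in> {j. j < Suc n * q \<and> \<not> q dvd j}"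
    then have "j \<noteq> ?i" by auto
    then show "j \<in> {j. j < ?i \<and> \<not> q dvd j} \<union> {Suc ?i..?k}" using j m by auto
  next
    fix j assume "j \<in> {j. j < ?i \<and> \<not> q dvd j} \<union> {Suc ?i..?k}"
    then show "j \<in> {j. j < Suc n * q \<and> \<not> q dvd j}" using nd[of j] m by auto
  qed
  then have U: "U (Suc n) = U n \<union> ?P" by (simp add: U_def interior_def image_Un)
  have fin: "finite (E n)" "finite ?B" "finite (U n)" "finite ?P"
    by (simp_all add: E_def U_def block_def)
  have disjE: "E n \<inter> ?B = {}" by (auto simp: E_def block_def)
  have disjU: "U n \<inter> ?P = {}"
  proof -
    have False if "j < ?i" "?i < l" "l \<le> ?k" "w j = w l" for j l
      using sep[of j l] nd[of l] that le m by simp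
    then show ?thesis by (fastforce simp: U_def interior_def)
  qed
  have w_P: "w j \<notin> ?P" if "j \<le> ?i" for j
  proof
    assume "w j \<in> ?P"
    then obtain l where "?i < l" "l \<le> ?k" "w j = w l" by (auto simp: interior_def Suc_le_eq)
    then show False using sep[of j l] nd[of l] that le m by simp
  qed
  have w_U: "w j \<notin> U n" if "?i \<le> j" "j \<le> ?i + q" for j
  proof
    assume "w j \<in> U n"
    then obtain l where "l < ?i" "\<not> q dvd l" "w j = w l" by (auto simp: U_def)
    then show False using sep[of j l] that le by simp
  qed
  have avoid1: "set_uprod (fan_ends w c e) \<inter> ?P = {}" if "e \<in> E n" for e
    using that w_P by (auto simp: E_def)
  have avoid2: "set_uprod (fan_ends w c e) \<inter> U n = {}" if "e \<in> ?B" for e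
    using that w_U center' m by (auto simp: block_def)
  have "num (E (Suc n)) (U (Suc n)) = num (E n) (U n) * num ?B ?P"
    unfolding E U by (rule num_ground_forests_Un[OF fin disjE disjU avoid1 avoid2])
  moreover have "num (E (Suc n)) (insert c (U (Suc n))) =
      num (E n) (insert c (U n)) * num ?B ?P + num (E n) (U n) * num ?B (insert c ?P)"
    unfolding E U
    by (rule num_ground_forests_parallel[OF fin disjE disjU center' center_notin_interior avoid1 avoid2])
  moreover have "num ?B ?P = fib (2 * q)" "num ?B (insert c ?P) = lucas (2 * q) - 2"
    using num_block[OF s] m by simp_all
  moreover have "num (E n) (U n) = fib (2 * q) ^ n"
    "num (E n) (insert c (U n)) = n * (lucas (2 * q) - 2) * fib (2 * q) ^ (n - 1)"
    using Suc by simp_all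
  moreover have "n * T * S ^ (n - 1) * S + S ^ n * T = Suc n * T * S ^ (Suc n - 1)" for S T :: nat
    by (cases n) (simp_all add: algebra_simps)
  ultimately show ?case by (simp only: power_Suc2)
qed

end

section \<open>The wheel\<close>

lemma wheel_simps [simp]:
  "verts (wheel N) = insert Center (Rim ` {1..N})"
  "edges (wheel N) = (\<lambda>i. Upair (Rim i) (Rim (i mod N + 1))) ` {1..N} \<union> (\<lambda>i. Upair Center (Rim i)) ` {1..N}"
  "ends (wheel N) = (\<lambda>e. e)"
  by (auto simp: wheel_def)

lemma finite_mgraph_wheel:
  assumes "N > 0"
  shows "finite_mgraph (wheel N)"
proof
  have "i mod N + 1 \<in> {1..N}" for i
    using mod_less_divisor[OF assms, of i] by auto
  then show "set_uprod (ends (wheel N) e) \<subseteq> verts (wheel N)" if "e \<in> edges (wheel N)" for e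
    using that by (auto simp del: atLeastAtMost_iff)
qed simp_all

text \<open>The offset \<open>b\<close> will put the first root at position 0. Positions wrap
  around, so position \<open>N\<close> is position 0 again.\<close>

definition rim_walk :: "nat \<Rightarrow> nat \<Rightarrow> nat \<Rightarrow> wheel_vertex" where
  "rim_walk N b k = Rim ((b + k) mod N + 1)"

lemma rim_walk_eq_iff: "rim_walk N b j = rim_walk N b l \<longleftrightarrow> j mod N = l mod N"
  using cong_add_lcancel_nat[of b j l N] by (simp add: rim_walk_def cong_def)

lemma image_rotate:
  fixes N b :: nat
  assumes "N > 0"
  shows "(\<lambda>k. (b + k) mod N + 1) ` {..<N} = {1..N}"
proof (rule card_subset_eq)
  have "inj_on (\<lambda>k. (b + k) mod N + 1) {..<N}"
    using rim_walk_eq_iff[of N b] by (auto simp: inj_on_def rim_walk_def)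
  then show "card ((\<lambda>k. (b + k) mod N + 1) ` {..<N}) = card {1..N}"
    by (simp add: card_image)
  show "(\<lambda>k. (b + k) mod N + 1) ` {..<N} \<subseteq> {1..N}"
    using assms by (auto simp: Suc_le_eq)
qed simp

lemma rim_walk_image: "N > 0 \<Longrightarrow> rim_walk N b ` {..<N} = Rim ` {1..N}"
  unfolding image_rotate[of N b, symmetric] by (simp add: image_image rim_walk_def)

lemma edges_wheel_eq:
  assumes "N > 0"
  shows "edges (wheel N) = fan_ends (rim_walk N b) Center ` (Inl ` {..<N} \<union> Inr ` {..<N})"
proof -
  have "((b + k) mod N + 1) mod N = (b + Suc k) mod N" for k
    by (simp add: mod_Suc_eq)
  then show ?thesis
    unfolding wheel_simps image_rotate[OF assms, of b, symmetric]
    by (simp add: image_image image_Un rim_walk_def)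
qed

text \<open>Two rim edges with the same ends in opposite order would give j + 2 = j modulo
  \<open>N\<close>, which \<open>N \<ge> 3\<close> excludes. Spokes differ from rim edges by
  containing the centre.\<close>

lemma inj_on_fan_ends_wheel:
  assumes "N \<ge> 3"
  shows "inj_on (fan_ends (rim_walk N b) Center) (Inl ` {..<N} \<union> Inr ` {..<N})"
proof -
  let ?w = "rim_walk N b"
  have c: "?w k \<noteq> Center" for k by (simp add: rim_walk_def)
  have eq: "j = l" if "?w j = ?w l" "j < N" "l < N" for j l
    using that by (simp add: rim_walk_eq_iff)
  have no: False if "?w j = ?w (Suc l)" "?w (Suc j) = ?w l" for j l
  proof -
    have "Suc l mod N = j mod N" "Suc j mod N = l mod N"
      using that by (simp_all add: rim_walk_eq_iff)
    then have "(j + 2) mod N = j mod N" by (metis mod_Suc_eq add_2_eq_Suc')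
    then have "[j + 2 = j + 0] (mod N)" by (simp add: cong_def)
    then have "[2 = 0] (mod N)" by (simp only: cong_add_lcancel_nat)
    then show False using assms by (simp add: cong_def)
  qed
  show ?thesis
  proof (rule inj_onI)
    fix e e' assume e: "e \<in> Inl ` {..<N} \<union> Inr ` {..<N}" "e' \<in> Inl ` {..<N} \<union> Inr ` {..<N}"
      and t: "fan_ends ?w Center e = fan_ends ?w Center e'"
    have c': "Center \<noteq> ?w k" for k using c[of k] by simp
    consider j l where "e = Inl j" "e' = Inl l" "j < N" "l < N"
      | j l where "e = Inl j" "e' = Inr l" | j l where "e = Inr j" "e' = Inl l"
      | j l where "e = Inr j" "e' = Inr l" "j < N" "l < N"
      using e by blast
    then show "e = e'"
    proof cases
      case (1 j l)
      then show ?thesis using t eq[of j l] no[of j l] by auto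
    next
      case (4 j l)
      then show ?thesis using t eq[of j l] c by auto
    qed (use t c c' in auto)
  qed
qed

theorem corollary3p3:
  fixes N r q :: nat and a :: "nat \<Rightarrow> nat" and R :: "wheel_vertex set"
  assumes "N \<ge> 3" and "N = r * q" and "r > 0" and "q > 0"
    and "strict_mono_on {1..r} a" and "a ` {1..r} \<subseteq> {1..N}"
    and "R = (\<lambda>i. Rim (a i)) ` {1..r}"
    and "\<forall>i\<in>{1..r}. cyclic_interval N r a i = q"
  shows "num_rooted_forests (wheel N) R = tau (identify (wheel N) R)
    \<and> int (tau (identify (wheel N) R))
        = int r * (int (lucas (2 * q)) - 2) * int (fib (2 * q)) ^ (r - 1)"
proof
  have N: "N > 0" using assms(1) by simp
  interpret W: finite_mgraph "wheel N" by (rule finite_mgraph_wheel[OF N])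
  have R: "R \<subseteq> verts (wheel N)" "R \<noteq> {}"
    using assms(3,6,7) by auto
  have trees: "spanning_trees (identify (wheel N) R) = rooted_spanning_forests (wheel N) R"
    by (rule W.spanning_trees_identify[OF R])
  then show "num_rooted_forests (wheel N) R = tau (identify (wheel N) R)"
    by (simp add: num_rooted_forests_def tau_def)
  define b where "b = a 1 - 1"
  let ?w = "rim_walk N b"
  interpret F: fan ?w Center by unfold_locales (simp add: rim_walk_def)
  let ?L = "Inl ` {..<N} \<union> Inr ` {..<N}" and ?U = "insert Center (?w ` {j. j < N \<and> \<not> q dvd j})"
  have "a 1 \<in> {1..N}" using assms(3) by (intro subsetD[OF assms(6)] imageI) simp
  then have a1: "a 1 = Suc b" by (simp add: b_def)
  have a: "a (Suc i) = Suc (b + i * q)" if "i < r" for i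
    using that
  proof (induction i)
    case (Suc i)
    have "cyclic_interval N r a (Suc i) = q" using assms(8) Suc.prems by simp
    then have "a (Suc (Suc i)) - a (Suc i) = q" using Suc.prems by (simp add: cyclic_interval_def)
    \<comment> \<open>As \<open>q > 0\<close>, a truncated difference equal to \<open>q\<close> is
      exact.\<close>
    then show ?case using Suc assms(4) by simp
  qed (use a1 in simp)
  have root: "?w (i * q) = Rim (a (Suc i))" if "i < r" for i
  proof -
    have "a (Suc i) \<in> {1..N}" using that by (intro subsetD[OF assms(6)] imageI) simp
    then have "b + i * q < N" using a[OF that] by simp
    then show ?thesis using a[OF that] by (simp add: rim_walk_def)
  qed
  have "R = (\<lambda>i. Rim (a (Suc i))) ` {..<r}"
  proof -
    have "{1..r} = Suc ` {..<r}" by (auto simp: image_Suc_lessThan)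
    then show ?thesis using assms(7) by (simp add: image_image)
  qed
  also have "\<dots> = (\<lambda>i. ?w (i * q)) ` {..<r}" using root by simp
  also have "\<dots> = ?w ` {j. j < N \<and> q dvd j}"
  proof -
    have "{j. j < N \<and> q dvd j} = (\<lambda>i. i * q) ` {..<r}"
      using assms(2,4) by (auto simp: dvd_def image_iff mult.commute)
    then show ?thesis by (simp add: image_image)
  qed
  finally have R_eq: "R = ?w ` {j. j < N \<and> q dvd j}" .
  have inj: "inj_on ?w {..<N}" by (simp add: inj_on_def rim_walk_eq_iff)
  have "?w ` {..<N} - R = ?w ` ({..<N} - {j. j < N \<and> q dvd j})"
    unfolding R_eq by (rule inj_on_image_set_diff[OF inj, symmetric]) auto
  also have "{..<N} - {j. j < N \<and> q dvd j} = {j. j < N \<and> \<not> q dvd j}" by auto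
  finally have "Rim ` {1..N} - R = ?w ` {j. j < N \<and> \<not> q dvd j}"
    unfolding rim_walk_image[OF N] .
  moreover have "Center \<notin> R" using assms(7) by auto
  ultimately have U: "verts (wheel N) - R = ?U" by (simp add: insert_Diff_if)
  \<comment> \<open>Among the positions up to \<open>N\<close>, only \<open>N\<close> wraps around;
    it meets position 0, which is a multiple of \<open>q\<close>.\<close>
  have sep: "j = l" if "j \<le> r * q" "l < r * q" "\<not> q dvd l" "?w j = ?w l" for j l
  proof (cases "j = N")
    case True
    then have "l = 0" using that assms(2) by (simp add: rim_walk_eq_iff)
    then show ?thesis using that by simp
  qed (use that assms(2) in \<open>simp add: rim_walk_eq_iff\<close>)
  have "tau (identify (wheel N) R) = num_ground_forests (\<lambda>e. e) (edges (wheel N)) ?U"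
    unfolding tau_def trees W.rooted_spanning_forests_eq_ground_forests[OF R(1)] U
    by (simp add: num_ground_forests_def)
  also have "\<dots> = F.num ?L ?U"
    unfolding edges_wheel_eq[OF N, of b]
    by (rule num_ground_forests_image[OF inj_on_fan_ends_wheel[OF assms(1)]])
  also have "\<dots> = r * (lucas (2 * q) - 2) * fib (2 * q) ^ (r - 1)"
    using F.num_blocks[OF assms(4) order_refl sep] assms(2) by simp
  finally have tau: "tau (identify (wheel N) R) = r * (lucas (2 * q) - 2) * fib (2 * q) ^ (r - 1)" .
  \<comment> \<open>The natural-number formula subtracts 2 with truncation; passing to integers
    needs \<open>lucas (2 * q) \<ge> 2\<close>.\<close>
  obtain m where "q = Suc m" using assms(4) by (cases q) auto
  then have "lucas (2 * q) = fib (2 * m + 1) + fib (2 * m + 3)"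
    by (simp add: lucas_eq_fib numeral_3_eq_3)
  moreover have "fib (2 * m + 1) > 0" "fib (2 * m + 3) > 0" by (simp_all add: fib_neq_0_nat)
  ultimately have "lucas (2 * q) \<ge> 2" by linarith
  then show "int (tau (identify (wheel N) R))
      = int r * (int (lucas (2 * q)) - 2) * int (fib (2 * q)) ^ (r - 1)"
    unfolding tau by (simp add: of_nat_diff)
qed

end
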